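(* Let $d\ge1$, let $1\le q<\infty$, and let $w$ be a discrete $A_q$-weight on $\mathbb{Z}^d$. Then an infinite matrix $A\in\mathcal{B}(\mathbb{Z}^d,\mathbb{Z}^d)$ has $\ell^q_w$-stability if and only if it has a left inverse in $\mathcal{B}(\ell^q_w)$, i.e. there is a bounded linear operator $B$ on $\ell^q_w$ with $BA=I$.
   Context: For $x=(x_1,\dots,x_d)\in\mathbb{R}^d$ put $|x|_\infty=\max(|x_1|,\dots,|x_d|)$. $\mathcal{B}(\mathbb{Z}^d,\mathbb{Z}^d)$ is the set of all complex infinite matrices $A=(a(i,j))_{i,j\in\mathbb{Z}^d}$ with $$\|A\|_{\mathcal{B}}:=\sum_{k\in\mathbb{Z}^d}\Big(\sup_{|i-j|_\infty\ge|k|_\infty}|a(i,j)|\Big)<\infty .$$ A positive sequence $w=(w(i))_{i\in\mathbb{Z}^d}$ is a discrete $A_q$-weight, for $1<q<\infty$, if there is a constant $C$ with $$\Big(N^{-d}\sum_{i\in a+[0,N-1]^d}w(i)\Big)\Big(N^{-d}\sum_{i\in a+[0,N-1]^d}w(i)^{-1/(q-1)}\Big)^{q-1}\le C$$ for all $a\in\mathbb{Z}^d$ and all integers $N\ge1$; it is a discrete $A_1$-weight if there is a constant $C$ with $N^{-d}\sum_{i\in a+[0,N-1]^d}w(i)\le C\inf_{i\in a+[0,N-1]^d}w(i)$ for all such $a,N$ (sums and infima over integer points). $\ell^q_w$ is the space of sequences $c=(c(i))_{i\in\mathbb{Z}^d}$ with $\|c\|_{q,w}:=(\sum_i|c(i)|^qw(i))^{1/q}<\infty$,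 and $\mathcal{B}(\ell^q_w)$ is the algebra of bounded linear operators on it. A matrix $A$ acts by $(Ac)(i)=\sum_{j}a(i,j)c(j)$ (matrices in $\mathcal{B}(\mathbb{Z}^d,\mathbb{Z}^d)$ define bounded operators on $\ell^q_w$). $A$ has $\ell^q_w$-stability if there is a positive constant $C$ such that $C^{-1}\|c\|_{q,w}\le\|Ac\|_{q,w}\le C\|c\|_{q,w}$ for all $c\in\ell^q_w$. *)

theory Defs
  imports "HOL-Analysis.Analysis"
begin

type_synonym 'd inf_matrix = "int ^ 'd \<Rightarrow> int ^ 'd \<Rightarrow> complex"

definition supnorm :: "int ^ 'd::finite \<Rightarrow> int" where
  "supnorm x = Max (range (\<lambda>n. \<bar>x $ n\<bar>))"

text \<open>Extended-real valued, so that an infinite supremum or a divergent sum gives \<open>\<infinity>\<close>.\<close>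

definition B_norm :: "'d::finite inf_matrix \<Rightarrow> ennreal" where
  "B_norm A =
     (\<Sum>\<^sub>\<infinity>k\<in>(UNIV :: (int ^ 'd) set). SUP (i, j) \<in> {(i, j). supnorm (i - j) \<ge> supnorm k}. ennreal (cmod (A i j)))"

definition B_class :: "'d::finite inf_matrix set" where
  "B_class = {A. B_norm A < \<infinity>}"

definition cube :: "int ^ 'd::finite \<Rightarrow> nat \<Rightarrow> (int ^ 'd) set" where
  "cube a N = {i. \<forall>n. a $ n \<le> i $ n \<and> i $ n \<le> a $ n + (int N - 1)}"

definition cube_avg :: "int ^ 'd::finite \<Rightarrow> nat \<Rightarrow> (int ^ 'd \<Rightarrow> real) \<Rightarrow> real" where
  "cube_avg a N f = (\<Sum>i\<in>cube a N. f i) / real N ^ CARD('d)"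

definition discrete_A_weight :: "real \<Rightarrow> (int ^ 'd::finite \<Rightarrow> real) \<Rightarrow> bool" where
  "discrete_A_weight q w \<longleftrightarrow>
     (\<forall>i. w i > 0) \<and>
     ((q = 1 \<and> (\<exists>C. \<forall>a. \<forall>N\<ge>1. cube_avg a N w \<le> C * (INF i\<in>cube a N. w i))) \<or>
      (q > 1 \<and> (\<exists>C. \<forall>a. \<forall>N\<ge>1.
         cube_avg a N w * (cube_avg a N (\<lambda>i. w i powr (- 1 / (q - 1)))) powr (q - 1) \<le> C)))"

definition lq :: "real \<Rightarrow> (int ^ 'd::finite \<Rightarrow> real) \<Rightarrow> (int ^ 'd \<Rightarrow> complex) set" where
  "lq q w = {c. (\<lambda>i. cmod (c i) powr q * w i) summable_on UNIV}"

definition lq_norm :: "real \<Rightarrow> (int ^ 'd::finite \<Rightarrow> real) \<Rightarrow> (int ^ 'd \<Rightarrow> complex) \<Rightarrow> real" where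
  "lq_norm q w c = (\<Sum>\<^sub>\<infinity>i\<in>UNIV. cmod (c i) powr q * w i) powr (1 / q)"

definition mat_app :: "'d::finite inf_matrix \<Rightarrow> (int ^ 'd \<Rightarrow> complex) \<Rightarrow> int ^ 'd \<Rightarrow> complex" where
  "mat_app A c = (\<lambda>i. \<Sum>\<^sub>\<infinity>j\<in>UNIV. A i j * c j)"

text \<open>An operator on \<open>lq q w\<close> is a total function on sequences of which only the restriction
  to \<open>lq q w\<close> matters.\<close>

definition bounded_op :: "real \<Rightarrow> (int ^ 'd::finite \<Rightarrow> real) \<Rightarrow>
    ((int ^ 'd \<Rightarrow> complex) \<Rightarrow> (int ^ 'd \<Rightarrow> complex)) \<Rightarrow> bool" where
  "bounded_op q w T \<longleftrightarrow>
     (\<forall>c\<in>lq q w. T c \<in> lq q w) \<and>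
     (\<forall>c\<in>lq q w. \<forall>c'\<in>lq q w. T (\<lambda>i. c i + c' i) = (\<lambda>i. T c i + T c' i)) \<and>
     (\<forall>c\<in>lq q w. \<forall>z::complex. T (\<lambda>i. z * c i) = (\<lambda>i. z * T c i)) \<and>
     (\<exists>K. \<forall>c\<in>lq q w. lq_norm q w (T c) \<le> K * lq_norm q w c)"

text \<open>The norm is real-valued and meaningless off \<open>lq q w\<close>, so the membership
  \<open>mat_app A c \<in> lq q w\<close> implied by \<open>\<parallel>Ac\<parallel> \<le> C \<parallel>c\<parallel> < \<infinity>\<close> is written out.\<close>

definition lq_stable :: "real \<Rightarrow> (int ^ 'd::finite \<Rightarrow> real) \<Rightarrow> 'd inf_matrix \<Rightarrow> bool" where
  "lq_stable q w A \<longleftrightarrow>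
     (\<exists>C>0. \<forall>c\<in>lq q w. mat_app A c \<in> lq q w \<and>
        inverse C * lq_norm q w c \<le> lq_norm q w (mat_app A c) \<and>
        lq_norm q w (mat_app A c) \<le> C * lq_norm q w c)"

text \<open>The membership makes the composition \<open>BA\<close> one of operators on \<open>lq q w\<close>.\<close>

definition has_left_inverse :: "real \<Rightarrow> (int ^ 'd::finite \<Rightarrow> real) \<Rightarrow> 'd inf_matrix \<Rightarrow> bool" where
  "has_left_inverse q w A \<longleftrightarrow>
     (\<exists>B. bounded_op q w B \<and> (\<forall>c\<in>lq q w. mat_app A c \<in> lq q w \<and> B (mat_app A c) = c))"

end

theory Submission
  imports Defs
begin

text \<open>
  Since \<open>w\<close> is an \<open>A\<^sub>q\<close>-weight, averages over cubes are bounded on \<open>\<ell>\<^sup>q\<^sub>w\<close> uniformly in the side length, and a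
  radially decreasing summable kernel is a superposition of such averages; hence every matrix
  of the Beurling class is bounded on \<open>\<ell>\<^sup>q\<^sub>w\<close>. This gives one direction at once.

  For the other one, stability is applied to \<open>\<psi> c\<close> with a cutoff \<open>\<psi>\<close> at scale \<open>N\<close>. The commutator
  \<open>[A, \<psi>]\<close> has small norm for large \<open>N\<close>, and the weighted \<open>q\<close>-averages of \<open>c\<close> over the cells of the grid
  \<open>N\<int>\<^sup>d\<close> satisfy a convolution inequality in which the weight no longer occurs. Solving it by a
  Neumann series gives, for all bounded \<open>c\<close>, a pointwise bound \<open>\<bar>c(i)\<bar> \<le> \<Sum>\<^sub>j \<omega>(i - j) \<bar>Ac(j)\<bar>\<close> with
  a radially decreasing summable \<open>\<omega>\<close>. In particular \<open>A\<close> is stable on unweighted \<open>\<ell>\<^sup>2\<close>, so \<open>T = A\<^sup>* A\<close> is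
  coercive there and has an inverse \<open>G\<close>. The pointwise bound for \<open>T\<close>, applied to the columns of \<open>G\<close>,
  shows that \<open>G\<close> is again in the Beurling class, and \<open>G\<^sup>* A\<^sup>*\<close> is a bounded left inverse on \<open>\<ell>\<^sup>q\<^sub>w\<close>.
\<close>

section \<open>Sums and powers of extended nonnegative reals\<close>

text \<open>The obstacle is that an A_q weight is comparable only between neighbouring cells; the
  masses of distant cells may have unbounded ratios, so a commutator estimate in the weighted norm
  alone cannot be summed. Hence the commutator is split at range \<open>N\<close>. Ranges up to
  \<open>N\<close> meet a fixed number of cells, whose masses are compared by doubling. Longer
  ranges are first bounded by plain sums of \<open>c\<close> over whole cells, and the A_q
  condition, in the form \<open>testing\<close>, controls such a sum by the normalized cell average
  with a constant free of \<open>w\<close>. The constant \<open>L\<close> obtained in this way does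
  not depend on \<open>N\<close>, so \<open>N\<close> can be chosen afterwards to make the recursion
  contract. The pointwise bound is the bridge between the spaces: it mentions neither
  \<open>q\<close> nor \<open>w\<close>, so it is proved in one space and used in another. All
  estimates run in \<open>ennreal\<close>, where sums may be swapped without summability.\<close>

abbreviation nsum :: "('a \<Rightarrow> ennreal) \<Rightarrow> ennreal" where
  "nsum f \<equiv> \<integral>\<^sup>+x. f x \<partial>count_space UNIV"

lemma nsum_swap:
  "nsum (\<lambda>x. nsum (\<lambda>y. F x y)) = nsum (\<lambda>y. nsum (\<lambda>x. F x y))"
  using nn_integral_fst_count_space[of "\<lambda>(x,y). F x y"] nn_integral_snd_count_space[of "\<lambda>(x,y). F x y"]
  by simp

lemma nsum_cmult: "nsum (\<lambda>x. c * f x) = c * nsum f"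
  by (rule nn_integral_cmult) simp

lemma nsum_multc: "nsum (\<lambda>x. f x * c) = nsum f * c"
  by (rule nn_integral_multc) simp

lemma nsum_add: "nsum (\<lambda>x. f x + g x) = nsum f + nsum g"
  by (rule nn_integral_add) simp_all

lemma nsum_mono: "(\<And>x. f x \<le> g x) \<Longrightarrow> nsum f \<le> nsum g"
  by (rule nn_integral_mono) simp

lemma sum_eq_nsum:
  assumes "finite S" shows "sum f S = nsum (\<lambda>x. if x \<in> S then f x else 0)"
proof -
  have "nsum (\<lambda>x. if x \<in> S then f x else 0) = (\<Sum>x\<in>S. if x \<in> S then f x else 0)"
    using assms by (intro nn_integral_count_space') auto
  then show ?thesis by simp
qed

lemma nsum_delta: "nsum (\<lambda>x. if x = a then f x else 0) = f a"
  using sum_eq_nsum[of "{a}" f] by simp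

lemma sum_le_nsum: "finite S \<Longrightarrow> sum f S \<le> nsum f"
  unfolding sum_eq_nsum by (rule nsum_mono) simp

lemma le_nsum: "f a \<le> nsum f"
  using sum_le_nsum[of "{a}" f] by simp

lemma nsum_eq_0: "nsum f = 0 \<longleftrightarrow> (\<forall>x. f x = 0)"
  by (subst nn_integral_0_iff_AE) (auto simp: AE_count_space)

section \<open>Real powers on [0, infinity], convexity and Jensen's inequality\<close>

definition epw :: "real \<Rightarrow> ennreal \<Rightarrow> ennreal" where
  "epw q x = (if x = top then top else ennreal (enn2real x powr q))"

lemma epw_ennreal: "0 \<le> r \<Longrightarrow> epw q (ennreal r) = ennreal (r powr q)"
  by (simp add: epw_def)

lemma epw_top [simp]: "epw q top = top"
  by (simp add: epw_def)

lemma epw_0 [simp]: "epw q 0 = 0"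
  by (simp add: epw_def)

lemma epw_1 [simp]: "epw q 1 = 1"
  by (simp add: epw_def)

lemma epw_mono: "0 < q \<Longrightarrow> x \<le> y \<Longrightarrow> epw q x \<le> epw q y"
  by (cases x; cases y) (auto simp: epw_ennreal top_unique intro!: ennreal_leI powr_mono2)

text \<open>True for every real exponent, also with factors 0 and \<open>top\<close>, because
  \<open>0 powr q = 0\<close> and \<open>0 * top = 0\<close>; volumes and constants can therefore be
  moved through powers freely.\<close>

lemma epw_mult: "epw q (x * y) = epw q x * epw q y"
  by (cases x; cases y)
    (auto simp: epw_def ennreal_mult[symmetric] powr_mult ennreal_mult_eq_top_iff ennreal_mult_top ennreal_top_mult)

lemma epw_epw: "p * q = 1 \<Longrightarrow> epw p (epw q x) = x"
  by (cases x) (auto simp: epw_ennreal powr_powr mult.commute)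

lemma epw_le_iff: "0 < q \<Longrightarrow> epw q x \<le> epw q y \<longleftrightarrow> x \<le> y"
  using epw_mono[of q x y] epw_mono[of "1/q" "epw q x" "epw q y"] by (auto simp: epw_epw)

lemma epw_eq_0 [simp]: "epw q x = 0 \<longleftrightarrow> x = 0"
  by (cases x) (auto simp: epw_ennreal)

lemma epw_eq_top [simp]: "epw q x = top \<longleftrightarrow> x = top"
  by (cases x) (auto simp: epw_ennreal)

lemma epw_less_top: "x < top \<Longrightarrow> epw q x < top"
  by (metis epw_eq_top less_top)

lemma epw_add_le:
  assumes "0 < q" shows "epw q (x + y) \<le> epw q 2 * (epw q x + epw q y)"
proof -
  have "epw q (x + y) \<le> epw q (2 * max x y)"
    using assms by (intro epw_mono) (auto simp: mult_2 add_mono)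
  also have "\<dots> = epw q 2 * epw q (max x y)" by (rule epw_mult)
  also have "\<dots> \<le> epw q 2 * (epw q x + epw q y)"
    by (rule mult_left_mono) (auto simp: max_def)
  finally show ?thesis .
qed

text \<open>Write \<open>(a + b) powr q\<close> as \<open>(a + b) * (a + b) powr (q - 1)\<close> and
  replace the second factor by the smaller \<open>a powr (q - 1)\<close>, respectively
  \<open>b powr (q - 1)\<close>.\<close>

lemma epw_superadditive:
  assumes "1 \<le> q" shows "epw q x + epw q y \<le> epw q (x + y)"
proof (cases x; cases y)
  fix a b assume *: "0 \<le> a" "x = ennreal a" "0 \<le> b" "y = ennreal b"
  have aux: "s powr q \<le> s * t powr (q - 1)" if "0 \<le> s" "s \<le> t" for s t :: real
  proof (cases "s = 0")
    case False
    then have "s powr q = s powr 1 * s powr (q - 1)" by (simp only: powr_add[symmetric]) simp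
    also have "\<dots> \<le> s powr 1 * t powr (q - 1)"
      using that assms by (intro mult_left_mono powr_mono2) auto
    finally show ?thesis using that False by simp
  qed simp
  have "a powr q + b powr q \<le> a * (a + b) powr (q - 1) + b * (a + b) powr (q - 1)"
    using * by (intro add_mono aux) auto
  also have "\<dots> = (a + b) powr q"
    using * powr_mult_base[of "a + b" "q - 1"] by (simp flip: distrib_right)
  finally show ?thesis using * by (simp add: epw_ennreal flip: ennreal_plus)
qed auto

lemma sum_epw_le:
  assumes "1 \<le> q" shows "(\<Sum>i\<in>S. epw q (f i)) \<le> epw q (\<Sum>i\<in>S. f i)"
proof (cases "finite S")
  case True
  then show ?thesis
  proof induction
    case (insert a S)
    have "epw q (f a) + (\<Sum>i\<in>S. epw q (f i)) \<le> epw q (f a) + epw q (\<Sum>i\<in>S. f i)"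
      by (rule add_left_mono) (rule insert.IH)
    also have "\<dots> \<le> epw q (f a + (\<Sum>i\<in>S. f i))" by (rule epw_superadditive[OF assms])
    finally show ?case using insert by simp
  qed simp
qed simp

text \<open>A convex function lies above its tangent at \<open>s\<close>; here this is Young's
  inequality with weights \<open>1 / q\<close> and \<open>(q - 1) / q\<close>. The constant term is
  moved to the right so that the inequality has a subtraction-free form in
  \<open>ennreal\<close>.\<close>

lemma powr_tangent:
  fixes s t q :: real
  assumes "1 \<le> q" "0 < s" "0 \<le> t"
  shows "q * s powr (q - 1) * t \<le> t powr q + (q - 1) * s powr q"
proof (cases "t = 0")
  case False
  have "(t powr q) powr (1/q) * (s powr q) powr ((q-1)/q) \<le> (1/q) * t powr q + ((q-1)/q) * s powr q"
    using assms False by (intro Youngs_inequality_0) (auto simp: field_simps)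
  moreover have "(t powr q) powr (1/q) * (s powr q) powr ((q-1)/q) = t * s powr (q - 1)"
    using assms False by (simp add: powr_powr)
  ultimately have "q * (t * s powr (q - 1)) \<le> q * ((1/q) * t powr q + ((q-1)/q) * s powr q)"
    using assms by (intro mult_left_mono) auto
  also have "\<dots> = t powr q + (q - 1) * s powr q"
    using assms by (simp add: distrib_left)
  finally show ?thesis by (simp add: ac_simps)
qed (use assms in auto)

lemma epw_tangent:
  assumes "1 \<le> q" "0 < s"
  shows "ennreal (q * s powr (q - 1)) * y \<le> epw q y + ennreal ((q - 1) * s powr q)"
  using powr_tangent[OF assms] assms
  by (cases y) (auto simp: epw_ennreal ennreal_mult[symmetric] ennreal_plus[symmetric] simp del: ennreal_plus)

text \<open>Jensen for the measure with masses \<open>a\<close>, multiplied out to avoid dividing by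
  the total mass. It follows by summing the tangent inequality at the mean value.\<close>

lemma nsum_jensen:
  assumes q: "1 \<le> q" and fin: "nsum a < top"
  shows "nsum a * epw q (nsum (\<lambda>i. a i * y i)) \<le> epw q (nsum a) * nsum (\<lambda>i. a i * epw q (y i))"
proof (cases "nsum a = 0 \<or> nsum (\<lambda>i. a i * epw q (y i)) = top")
  case True
  then show ?thesis by (auto simp: ennreal_mult_top)
next
  case False
  have T: "ennreal (q * s powr (q - 1)) * nsum (\<lambda>i. a i * y i)
      \<le> nsum (\<lambda>i. a i * epw q (y i)) + ennreal ((q - 1) * s powr q) * nsum a" if "0 < s" for s
  proof -
    have "ennreal (q * s powr (q - 1)) * nsum (\<lambda>i. a i * y i)
      = nsum (\<lambda>i. a i * (ennreal (q * s powr (q - 1)) * y i))"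
      by (subst nsum_cmult[symmetric]) (simp add: ac_simps)
    also have "\<dots> \<le> nsum (\<lambda>i. a i * (epw q (y i) + ennreal ((q - 1) * s powr q)))"
      using epw_tangent[OF q that] by (intro nsum_mono mult_left_mono) auto
    also have "\<dots> = nsum (\<lambda>i. a i * epw q (y i)) + ennreal ((q - 1) * s powr q) * nsum a"
      by (simp add: distrib_left nsum_add nsum_multc mult.commute)
    finally show ?thesis .
  qed
  obtain \<alpha> where \<alpha>: "nsum a = ennreal \<alpha>" "0 < \<alpha>"
    using fin False by (cases "nsum a") (auto simp: less_le)
  obtain I where I: "nsum (\<lambda>i. a i * epw q (y i)) = ennreal I" "0 \<le> I"
    using False by (cases "nsum (\<lambda>i. a i * epw q (y i))") auto
  \<comment> \<open>The tangent at 1 bounds the linear sum by the sum of powers, which is finite in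
    this case.\<close>
  have "nsum (\<lambda>i. a i * y i) < top"
    using T[of 1] \<alpha> I q by (cases "nsum (\<lambda>i. a i * y i)") (auto simp: ennreal_mult[symmetric] ennreal_plus[symmetric] ennreal_mult_top top_unique simp del: ennreal_plus)
  then obtain Y where Y: "nsum (\<lambda>i. a i * y i) = ennreal Y" "0 \<le> Y"
    by (cases "nsum (\<lambda>i. a i * y i)") auto
  have "\<alpha> * Y powr q \<le> \<alpha> powr q * I"
  proof (cases "Y = 0")
    case False
    \<comment> \<open>The mean of \<open>y\<close>, an optimal tangent point.\<close>
    define s where "s = Y / \<alpha>"
    have s: "0 < s" using False Y \<alpha> by (simp add: s_def)
    have "q * s powr (q - 1) * Y \<le> I + (q - 1) * s powr q * \<alpha>"
      using T[OF s] \<alpha> I Y q by (simp add: ennreal_mult[symmetric] ennreal_plus[symmetric] del: ennreal_plus)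
    moreover have "q * s powr (q - 1) * Y = q * (s powr q * \<alpha>)"
    proof -
      have "Y = s * \<alpha>" using \<alpha> by (simp add: s_def)
      then show ?thesis using powr_mult_base[of s "q - 1"] s by (simp add: ac_simps)
    qed
    ultimately have "q * (s powr q * \<alpha>) \<le> I + (q - 1) * s powr q * \<alpha>" by linarith
    also have "(q - 1) * s powr q * \<alpha> = q * (s powr q * \<alpha>) - s powr q * \<alpha>"
      by (simp add: left_diff_distrib)
    finally have "s powr q * \<alpha> \<le> I" by simp
    then have "Y powr q * \<alpha> \<le> I * \<alpha> powr q"
      using \<alpha> Y by (simp add: s_def powr_divide field_simps)
    then show ?thesis by (simp add: mult.commute)
  qed (use \<alpha> I in auto)
  then show ?thesis
    using \<alpha> I Y by (simp add: epw_ennreal ennreal_mult[symmetric])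
qed

section \<open>Superpositions of averages over cubes\<close>

lemma supnorm_le_iff: "supnorm x \<le> r \<longleftrightarrow> (\<forall>n. \<bar>x $ n\<bar> \<le> r)"
  unfolding supnorm_def by (subst Max_le_iff) auto

lemma supnorm_nonneg: "0 \<le> supnorm x"
  by (metis abs_ge_zero order_refl order_trans supnorm_le_iff)

lemma supnorm_minus_commute: "supnorm (x - y) = supnorm (y - x)"
  unfolding supnorm_def by (simp add: abs_minus_commute)

lemma supnorm_triangle: "supnorm (x + y) \<le> supnorm x + supnorm y"
proof -
  have "\<bar>(x + y) $ n\<bar> \<le> supnorm x + supnorm y" for n
  proof -
    have "\<bar>x $ n\<bar> \<le> supnorm x" "\<bar>y $ n\<bar> \<le> supnorm y"
      using supnorm_le_iff[of x "supnorm x"] supnorm_le_iff[of y "supnorm y"] by auto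
    then show ?thesis by simp
  qed
  then show ?thesis by (simp add: supnorm_le_iff)
qed

definition nb :: "int ^ 'd::finite \<Rightarrow> nat \<Rightarrow> (int ^ 'd) set" where
  "nb x R = {j. supnorm (j - x) \<le> int R}"

lemma mem_nb: "j \<in> nb x R \<longleftrightarrow> (\<forall>n. \<bar>j $ n - x $ n\<bar> \<le> int R)"
  by (simp add: nb_def supnorm_le_iff)

lemma mem_nb_commute: "j \<in> nb x R \<longleftrightarrow> x \<in> nb j R"
  by (simp add: nb_def supnorm_minus_commute)

lemma self_mem_nb [simp]: "x \<in> nb x R"
  by (simp add: mem_nb)

lemma nb_trans: "j \<in> nb x R \<Longrightarrow> k \<in> nb j S \<Longrightarrow> R + S \<le> T \<Longrightarrow> k \<in> nb x T"
  unfolding mem_nb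
proof
  fix n assume "\<forall>n. \<bar>j $ n - x $ n\<bar> \<le> int R" "\<forall>n. \<bar>k $ n - j $ n\<bar> \<le> int S" "R + S \<le> T"
  then have "\<bar>j $ n - x $ n\<bar> \<le> int R" "\<bar>k $ n - j $ n\<bar> \<le> int S" "int R + int S \<le> int T" by auto
  then show "\<bar>k $ n - x $ n\<bar> \<le> int T" by linarith
qed

lemma nb_mono: "R \<le> S \<Longrightarrow> nb x R \<subseteq> nb x S"
  using nb_trans[of _ x R _ 0 S] by auto

lemma nb_0 [simp]: "nb x 0 = {x}"
  by (auto simp: mem_nb vec_eq_iff)

lemma cube_eq_image:
  "cube a N = vec_lambda ` (PiE UNIV (\<lambda>n. {a $ n .. a $ n + (int N - 1)}))"
proof (intro equalityI subsetI)
  fix i assume "i \<in> cube a N"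
  then show "i \<in> vec_lambda ` (PiE UNIV (\<lambda>n. {a $ n .. a $ n + (int N - 1)}))"
    by (intro image_eqI[where x="vec_nth i"]) (auto simp: cube_def)
qed (auto simp: cube_def PiE_iff)

lemma finite_cube: "finite (cube a N)"
  unfolding cube_eq_image by (intro finite_imageI finite_PiE) auto

lemma card_cube: "card (cube (a :: int ^ 'd::finite) N) = N ^ CARD('d)"
proof -
  have "card (cube a N) = card (PiE UNIV (\<lambda>n. {a $ n .. a $ n + (int N - 1)}))"
    unfolding cube_eq_image by (intro card_image inj_onI) (metis vec_lambda_inverse UNIV_I)
  then show ?thesis by (simp add: card_PiE)
qed

lemma nb_eq_cube: "nb x R = cube (\<chi> n. x $ n - int R) (2 * R + 1)"
  unfolding cube_def set_eq_iff mem_Collect_eq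
proof
  fix j :: "int ^ 'a"
  have "(\<bar>j $ n - x $ n\<bar> \<le> int R) = (x $ n - int R \<le> j $ n \<and> j $ n \<le> x $ n - int R + (int (2 * R + 1) - 1))" for n
    by auto
  then show "(j \<in> nb x R) = (\<forall>n. (\<chi> n. x $ n - int R) $ n \<le> j $ n \<and> j $ n \<le> (\<chi> n. x $ n - int R) $ n + (int (2 * R + 1) - 1))"
    by (simp add: mem_nb)
qed

lemma finite_nb [simp]: "finite (nb x R)"
  by (simp add: nb_eq_cube finite_cube)

lemma card_nb: "card (nb (x :: int ^ 'd::finite) R) = (2 * R + 1) ^ CARD('d)"
  by (simp only: nb_eq_cube card_cube)

definition vol :: "nat \<Rightarrow> nat \<Rightarrow> ennreal" where
  "vol d R = of_nat ((2 * R + 1) ^ d)"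

lemma sum_const_nb: "(\<Sum>j\<in>nb (x :: int ^ 'd::finite) R. c) = vol CARD('d) R * c"
  by (simp add: card_nb vol_def)

lemma vol_less_top: "vol d R < top"
  unfolding vol_def by (rule of_nat_less_top)

lemma vol_ge_1: "1 \<le> vol d R"
proof -
  have "of_nat 1 \<le> (of_nat ((2 * R + 1) ^ d) :: ennreal)"
    by (rule of_nat_mono) simp
  then show ?thesis by (simp add: vol_def)
qed

lemma vol_nonzero: "vol d R \<noteq> 0"
  using vol_ge_1[of d R] by auto

lemma vol_0 [simp]: "vol d 0 = 1"
  by (simp add: vol_def)

lemma vol_le_scaled:
  assumes "2 * S + 1 \<le> c * (2 * R + 1)" shows "vol d S \<le> of_nat (c ^ d) * vol d R"
proof -
  have "of_nat ((2 * S + 1) ^ d) \<le> (of_nat ((c * (2 * R + 1)) ^ d) :: ennreal)"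
    using assms by (intro of_nat_mono power_mono) auto
  then show ?thesis unfolding vol_def power_mult_distrib of_nat_mult .
qed

lemma vol_mult_le_scaled:
  assumes "(2 * S + 1) * (2 * T + 1) \<le> c * (2 * R + 1)" shows "vol d S * vol d T \<le> of_nat (c ^ d) * vol d R"
proof -
  have "of_nat (((2 * S + 1) * (2 * T + 1)) ^ d) \<le> (of_nat ((c * (2 * R + 1)) ^ d) :: ennreal)"
    using assms by (intro of_nat_mono power_mono) auto
  then show ?thesis unfolding vol_def power_mult_distrib of_nat_mult .
qed

lemma nsum_nb_swap:
  "nsum (\<lambda>i. \<Sum>y\<in>nb i R. F i y) = nsum (\<lambda>y. \<Sum>i\<in>nb y R. F i y)"
proof -
  have "nsum (\<lambda>i. \<Sum>y\<in>nb i R. F i y) = nsum (\<lambda>i. nsum (\<lambda>y. if y \<in> nb i R then F i y else 0))"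
    by (simp add: sum_eq_nsum)
  also have "\<dots> = nsum (\<lambda>y. nsum (\<lambda>i. if i \<in> nb y R then F i y else 0))"
    by (subst nsum_swap) (simp add: mem_nb_commute)
  finally show ?thesis by (simp add: sum_eq_nsum)
qed

text \<open>The profile \<open>a\<close> encodes the radially decreasing kernel \<open>k \<mapsto> \<Sum>R \<ge> \<bar>k\<bar>\<^sub>\<infinity>. a R\<close>, whose sum over
  all \<open>k\<close> is \<open>pnorm d a\<close>.\<close>

definition pnorm :: "nat \<Rightarrow> (nat \<Rightarrow> ennreal) \<Rightarrow> ennreal" where
  "pnorm d a = nsum (\<lambda>R. a R * vol d R)"

definition kern :: "(nat \<Rightarrow> ennreal) \<Rightarrow> int ^ 'd::finite \<Rightarrow> ennreal" where
  "kern a k = nsum (\<lambda>R. a R * of_bool (supnorm k \<le> int R))"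

text \<open>Convolution with \<open>kern a\<close>, written as a superposition of ball sums so that
  an estimate for a single ball carries over; \<open>kop_kern\<close> gives the usual form.\<close>

definition kop :: "(nat \<Rightarrow> ennreal) \<Rightarrow> (int ^ 'd::finite \<Rightarrow> ennreal) \<Rightarrow> int ^ 'd \<Rightarrow> ennreal" where
  "kop a f i = nsum (\<lambda>R. a R * (\<Sum>j\<in>nb i R. f j))"

lemma kern_commute: "kern a (i - j) = kern a (j - i)"
  by (simp add: kern_def supnorm_minus_commute)

lemma kern_diff: "kern a (i - j) = nsum (\<lambda>R. a R * of_bool (j \<in> nb i R))"
  by (simp add: kern_def nb_def supnorm_minus_commute)

lemma kop_kern: "nsum (\<lambda>j. kern a (i - j) * f j) = kop a f i"
proof -
  have "nsum (\<lambda>j. kern a (i - j) * f j) = nsum (\<lambda>j. nsum (\<lambda>R. a R * (if j \<in> nb i R then f j else 0)))"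
    unfolding kern_diff nsum_multc[symmetric] by (intro nn_integral_cong) auto
  also have "\<dots> = kop a f i"
    by (subst nsum_swap) (simp add: kop_def nsum_cmult sum_eq_nsum)
  finally show ?thesis .
qed

lemma kop_mono: "(\<And>j. f j \<le> g j) \<Longrightarrow> kop a f i \<le> kop a g i"
  unfolding kop_def by (intro nsum_mono mult_left_mono sum_mono) auto

lemma kop_add: "kop a (\<lambda>j. f j + g j) i = kop a f i + kop a g i"
  unfolding kop_def by (simp add: sum.distrib distrib_left nsum_add)

lemma kop_cmult: "kop a (\<lambda>j. c * f j) i = c * kop a f i"
  unfolding kop_def by (simp add: nsum_cmult[symmetric] sum_distrib_left[symmetric] ac_simps)

lemma kop_const: "kop a (\<lambda>j. c) (i :: int ^ 'd::finite) = pnorm CARD('d) a * c"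
  unfolding kop_def pnorm_def by (simp add: sum_const_nb nsum_multc mult.assoc[symmetric] del: sum_constant)

lemma kop_delta: "kop a (\<lambda>l. if l = j then c else 0) i = kern a (i - j) * c"
proof -
  have "kop a (\<lambda>l. if l = j then c else 0) i = nsum (\<lambda>l. if l = j then kern a (i - l) * c else 0)"
    unfolding kop_kern[symmetric] by (intro nn_integral_cong) auto
  then show ?thesis by (simp add: nsum_delta)
qed

text \<open>The image of the masses \<open>a\<close> under the map \<open>r\<close>, with
  \<open>nsum_rix\<close> as change of variables. It regroups a profile by a new radius.\<close>

definition rix :: "('s \<Rightarrow> ennreal) \<Rightarrow> ('s \<Rightarrow> nat) \<Rightarrow> nat \<Rightarrow> ennreal" where
  "rix a r n = nsum (\<lambda>s. if r s = n then a s else 0)"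

lemma nsum_rix: "nsum (\<lambda>n. rix a r n * \<phi> n) = nsum (\<lambda>s. a s * \<phi> (r s))"
proof -
  have "nsum (\<lambda>n. rix a r n * \<phi> n) = nsum (\<lambda>n. nsum (\<lambda>s. if n = r s then a s * \<phi> n else 0))"
    unfolding rix_def nsum_multc[symmetric] by (intro nn_integral_cong) auto
  also have "\<dots> = nsum (\<lambda>s. a s * \<phi> (r s))"
    by (subst nsum_swap) (simp add: nsum_delta)
  finally show ?thesis .
qed

lemma nsum_prod: "nsum (\<lambda>(x, y). f x y) = nsum (\<lambda>x. nsum (\<lambda>y. f x y))"
  using nn_integral_fst_count_space[of "\<lambda>(x,y). f x y"] by simp

text \<open>The convolution of the indicators of two balls of radii \<open>R\<close> and
  \<open>S\<close> is supported in the ball of radius \<open>R + S\<close> and is at most the volume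
  of the smaller ball. Replacing it by this bound gives a profile again.\<close>

definition pconv :: "nat \<Rightarrow> (nat \<Rightarrow> ennreal) \<Rightarrow> (nat \<Rightarrow> ennreal) \<Rightarrow> nat \<Rightarrow> ennreal" where
  "pconv d a b = rix (\<lambda>(R, S). a R * b S * vol d (min R S)) (\<lambda>(R, S). R + S)"

lemma nsum_pconv:
  "nsum (\<lambda>n. pconv d a b n * \<phi> n) = nsum (\<lambda>R. nsum (\<lambda>S. a R * b S * vol d (min R S) * \<phi> (R + S)))"
  unfolding pconv_def nsum_rix by (simp add: nsum_prod[symmetric] case_prod_beta)

text \<open>Since \<open>2 * (R + S) + 1 \<le> 2 * (2 * max R S + 1)\<close>, the ball of radius
  \<open>R + S\<close> costs at most \<open>2 ^ d\<close> times the larger ball, and the volumes of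
  smaller and larger ball have the right product. So \<open>pnorm\<close> is an algebra norm up to
  \<open>2 ^ d\<close>.\<close>

lemma pnorm_pconv_le: "pnorm d (pconv d a b) \<le> 2 ^ d * pnorm d a * pnorm d b"
proof -
  have *: "vol d (min R S) * vol d (R + S) \<le> of_nat (2 ^ d) * (vol d R * vol d S)" for R S
  proof -
    have "vol d (R + S) \<le> of_nat (2 ^ d) * vol d (max R S)"
      by (rule vol_le_scaled) simp
    then have "vol d (min R S) * vol d (R + S) \<le> vol d (min R S) * (of_nat (2 ^ d) * vol d (max R S))"
      by (intro mult_left_mono) auto
    also have "\<dots> = of_nat (2 ^ d) * (vol d R * vol d S)"
      by (cases "R \<le> S") (simp_all add: min_def max_def ac_simps)
    finally show ?thesis .
  qed
  have "pnorm d (pconv d a b) \<le> nsum (\<lambda>R. nsum (\<lambda>S. a R * b S * (of_nat (2 ^ d) * (vol d R * vol d S))))"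
    unfolding pnorm_def nsum_pconv mult.assoc using * by (intro nsum_mono mult_left_mono) auto
  also have "\<dots> = nsum (\<lambda>R. nsum (\<lambda>S. (of_nat (2 ^ d) * (a R * vol d R)) * (b S * vol d S)))"
    by (simp add: ac_simps)
  also have "\<dots> = 2 ^ d * pnorm d a * pnorm d b"
    by (simp add: nsum_cmult nsum_multc pnorm_def)
  finally show ?thesis .
qed

lemma kern_conv_le:
  fixes i j :: "int ^ 'd::finite"
  shows "nsum (\<lambda>l. kern a (i - l) * kern b (l - j)) \<le> kern (pconv CARD('d) a b) (i - j)"
proof -
  have "nsum (\<lambda>l. kern a (i - l) * kern b (l - j))
      = nsum (\<lambda>l. nsum (\<lambda>R. nsum (\<lambda>S. a R * b S * of_bool (l \<in> nb i R \<and> l \<in> nb j S))))"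
  proof (intro nn_integral_cong)
    fix l
    have "kern a (i - l) * kern b (l - j)
      = nsum (\<lambda>R. nsum (\<lambda>S. (a R * of_bool (l \<in> nb i R)) * (b S * of_bool (l \<in> nb j S))))"
      unfolding kern_diff[of a i] kern_commute[of b l] kern_diff[of b j] by (simp only: nsum_cmult nsum_multc)
    also have "\<dots> = nsum (\<lambda>R. nsum (\<lambda>S. a R * b S * of_bool (l \<in> nb i R \<and> l \<in> nb j S)))"
      by (intro nn_integral_cong) auto
    finally show "kern a (i - l) * kern b (l - j) = nsum (\<lambda>R. nsum (\<lambda>S. a R * b S * of_bool (l \<in> nb i R \<and> l \<in> nb j S)))" .
  qed
  also have "\<dots> = nsum (\<lambda>R. nsum (\<lambda>l. nsum (\<lambda>S. a R * b S * of_bool (l \<in> nb i R \<and> l \<in> nb j S))))"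
    by (rule nsum_swap)
  also have "\<dots> = nsum (\<lambda>R. nsum (\<lambda>S. nsum (\<lambda>l. a R * b S * of_bool (l \<in> nb i R \<and> l \<in> nb j S))))"
    by (intro nn_integral_cong nsum_swap)
  also have "\<dots> = nsum (\<lambda>R. nsum (\<lambda>S. a R * b S * nsum (\<lambda>l. of_bool (l \<in> nb i R \<and> l \<in> nb j S))))"
    by (simp only: nsum_cmult)
  also have "\<dots> \<le> nsum (\<lambda>R. nsum (\<lambda>S. a R * b S * (vol CARD('d) (min R S) * of_bool (j \<in> nb i (R + S)))))"
  proof (intro nsum_mono mult_left_mono)
    fix R S
    show "nsum (\<lambda>l. of_bool (l \<in> nb i R \<and> l \<in> nb j S)) \<le> vol CARD('d) (min R S) * of_bool (j \<in> nb i (R + S))"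
    proof (cases "j \<in> nb i (R + S)")
      case True
      have "nsum (\<lambda>l. of_bool (l \<in> nb i R \<and> l \<in> nb j S)) \<le> nsum (\<lambda>l. if l \<in> nb (if R \<le> S then i else j) (min R S) then 1 else 0)"
        by (intro nsum_mono) auto
      also have "\<dots> = vol CARD('d) (min R S)"
        by (subst sum_eq_nsum[symmetric]) (simp_all only: sum_const_nb finite_nb mult_1_right)
      finally show ?thesis using True by simp
    next
      case False
      have "\<not> (l \<in> nb i R \<and> l \<in> nb j S)" for l
        using nb_trans[of l i R j S "R + S"] False by (auto simp: mem_nb_commute)
      then have "nsum (\<lambda>l. of_bool (l \<in> nb i R \<and> l \<in> nb j S)) = nsum (\<lambda>l::int ^ 'd. 0)"
        by (intro nn_integral_cong) auto
      then show ?thesis using False by simp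
    qed
  qed simp
  also have "\<dots> = kern (pconv CARD('d) a b) (i - j)"
    unfolding kern_diff nsum_pconv by (simp add: ac_simps)
  finally show ?thesis .
qed

lemma kop_kop_le:
  fixes i :: "int ^ 'd::finite"
  shows "kop a (kop b f) i \<le> kop (pconv CARD('d) a b) f i"
proof -
  have "kop a (kop b f) i = nsum (\<lambda>j. nsum (\<lambda>l. kern a (i - j) * kern b (j - l) * f l))"
    unfolding kop_kern[symmetric] by (simp add: nsum_cmult[symmetric] mult.assoc)
  also have "\<dots> = nsum (\<lambda>l. nsum (\<lambda>j. kern a (i - j) * kern b (j - l)) * f l)"
    by (subst nsum_swap) (simp add: nsum_multc)
  also have "\<dots> \<le> nsum (\<lambda>l. kern (pconv CARD('d) a b) (i - l) * f l)"
    by (intro nsum_mono mult_right_mono kern_conv_le) simp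
  finally show ?thesis by (simp add: kop_kern)
qed

section \<open>Averages on weighted spaces\<close>

text \<open>Both powers of 2 come from enlarging \<open>R\<close> to \<open>2 * R\<close> in
  \<open>Nrm_average_le\<close>: one from the q-th power of the volume in \<open>testing\<close>,
  one from counting the centres.\<close>

definition avg_const :: "nat \<Rightarrow> real \<Rightarrow> ennreal \<Rightarrow> ennreal" where
  "avg_const d q C = C * epw q (of_nat (2 ^ d)) * of_nat (2 ^ d)"

text \<open>\<open>testing\<close> says that averaging over a ball is bounded in the weighted norm,
  uniformly in the ball. It follows from the A_q condition by Hoelder and has the same form for
  \<open>q = 1\<close> and \<open>q > 1\<close>.\<close>

locale aq_weight =
  fixes q :: real and w :: "int ^ 'd::finite \<Rightarrow> ennreal" and C0 :: ennreal
  assumes q: "1 \<le> q"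
    and w_pos: "0 < w i"
    and w_fin: "w i < top"
    and C0_fin: "C0 < top"
    and testing: "epw q (\<Sum>j\<in>nb x R. f j) * (\<Sum>j\<in>nb x R. w j)
      \<le> C0 * epw q (vol CARD('d) R) * (\<Sum>j\<in>nb x R. w j * epw q (f j))"
begin

abbreviation W :: "int ^ 'd \<Rightarrow> nat \<Rightarrow> ennreal" where
  "W x R \<equiv> \<Sum>j\<in>nb x R. w j"

definition Nrm :: "(int ^ 'd \<Rightarrow> ennreal) \<Rightarrow> ennreal" where
  "Nrm f = nsum (\<lambda>i. w i * epw q (f i))"

lemma q_pos: "0 < q" using q by simp

lemma W_fin: "W x R < top"
proof -
  have "w i \<noteq> top" for i using w_fin[of i] by auto
  then show ?thesis by (auto simp: less_top[symmetric])
qed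

lemma w_le_W: "j \<in> nb x R \<Longrightarrow> w j \<le> W x R"
  by (rule member_le_sum) auto

lemma W_nonzero: "W x R \<noteq> 0"
  using w_le_W[of x x R] w_pos[of x] by (metis leD self_mem_nb)

lemma W_mono: "nb x R \<subseteq> nb y S \<Longrightarrow> W x R \<le> W y S"
  by (rule sum_mono2) auto

lemma avg_const_fin: "avg_const CARD('d) q C0 < top"
proof -
  have "epw q (of_nat (2 ^ CARD('d))) < top"
    by (rule epw_less_top) (rule of_nat_less_top)
  then show ?thesis unfolding avg_const_def using C0_fin by (intro ennreal_mult_less_top[THEN iffD2] conjI disjI2 of_nat_less_top) auto
qed

lemma Nrm_mono: "(\<And>i. f i \<le> g i) \<Longrightarrow> Nrm f \<le> Nrm g"
  unfolding Nrm_def by (intro nsum_mono mult_left_mono epw_mono q_pos) auto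

lemma Nrm_add_le: "Nrm (\<lambda>i. f i + g i) \<le> epw q 2 * (Nrm f + Nrm g)"
proof -
  have "Nrm (\<lambda>i. f i + g i) \<le> nsum (\<lambda>i. w i * (epw q 2 * (epw q (f i) + epw q (g i))))"
    unfolding Nrm_def by (intro nsum_mono mult_left_mono epw_add_le q_pos) auto
  also have "\<dots> = nsum (\<lambda>i. epw q 2 * (w i * epw q (f i) + w i * epw q (g i)))"
    by (intro nn_integral_cong) (simp add: distrib_left ac_simps)
  also have "\<dots> = epw q 2 * (Nrm f + Nrm g)"
    by (simp only: nsum_cmult nsum_add Nrm_def)
  finally show ?thesis .
qed

lemma Nrm_restrict:
  assumes "finite S" shows "Nrm (\<lambda>i. if i \<in> S then f i else 0) = (\<Sum>i\<in>S. w i * epw q (f i))"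
  unfolding Nrm_def sum_eq_nsum[OF assms] by (intro nn_integral_cong) auto

text \<open>The indicator of the smaller ball is inserted in \<open>testing\<close>: a sub-ball of
  comparable volume carries a comparable share of the weight.\<close>

lemma doubling:
  assumes "nb y S \<subseteq> nb x R"
  shows "epw q (vol CARD('d) S) * W x R \<le> C0 * epw q (vol CARD('d) R) * W y S"
proof -
  have *: "(\<Sum>j\<in>nb x R. if j \<in> nb y S then g j else 0) = sum g (nb y S)" for g :: "_ \<Rightarrow> ennreal"
    using assms by (subst sum.inter_restrict[symmetric]) (auto intro!: sum.cong)
  have "epw q (\<Sum>j\<in>nb x R. if j \<in> nb y S then 1 else 0) * W x R
      \<le> C0 * epw q (vol CARD('d) R) * (\<Sum>j\<in>nb x R. w j * epw q (if j \<in> nb y S then 1 else 0))"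
    by (rule testing)
  also have "(\<Sum>j\<in>nb x R. w j * epw q (if j \<in> nb y S then 1 else 0)) = (\<Sum>j\<in>nb x R. if j \<in> nb y S then w j else 0)"
    by (intro sum.cong) auto
  finally show ?thesis
    unfolding * using sum_const_nb[of "1::ennreal" y S] by simp
qed

text \<open>Sliding rather than tiling: \<open>nb i R \<subseteq> nb y (2 * R)\<close> for every \<open>y \<in> nb i R\<close>, and
  averaging over \<open>y\<close> replaces \<open>w i\<close> by the mass of a cube.\<close>

lemma Nrm_average_le:
  "Nrm (\<lambda>i. \<Sum>j\<in>nb i R. f j) \<le> avg_const CARD('d) q C0 * epw q (vol CARD('d) R) * Nrm f"
proof -
  let ?v = "vol CARD('d)" and ?S = "\<lambda>y. \<Sum>j\<in>nb y (2 * R). f j"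
  have "?v R * Nrm (\<lambda>i. \<Sum>j\<in>nb i R. f j) = nsum (\<lambda>i. \<Sum>y\<in>nb i R. w i * epw q (\<Sum>j\<in>nb i R. f j))"
    unfolding Nrm_def by (simp only: sum_const_nb nsum_cmult)
  also have "\<dots> \<le> nsum (\<lambda>i. \<Sum>y\<in>nb i R. w i * epw q (?S y))"
  proof (intro nsum_mono sum_mono mult_left_mono epw_mono q_pos sum_mono2)
    fix i y :: "int ^ 'd" assume "y \<in> nb i R"
    then show "nb i R \<subseteq> nb y (2 * R)"
      using nb_trans[of i y R _ R "2 * R"] by (auto simp: mem_nb_commute[of y])
  qed auto
  also have "\<dots> = nsum (\<lambda>y. epw q (?S y) * W y R)"
    by (subst nsum_nb_swap) (simp add: sum_distrib_right mult.commute)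
  also have "\<dots> \<le> nsum (\<lambda>y. epw q (?S y) * W y (2 * R))"
    by (intro nsum_mono mult_left_mono W_mono nb_mono) auto
  also have "\<dots> \<le> nsum (\<lambda>y. C0 * epw q (?v (2 * R)) * (\<Sum>j\<in>nb y (2 * R). w j * epw q (f j)))"
    by (intro nsum_mono testing)
  also have "\<dots> = C0 * epw q (?v (2 * R)) * nsum (\<lambda>j. \<Sum>y\<in>nb j (2 * R). w j * epw q (f j))"
    by (simp only: nsum_cmult nsum_nb_swap[where F="\<lambda>y j. w j * epw q (f j)"])
  also have "\<dots> = C0 * epw q (?v (2 * R)) * (?v (2 * R) * Nrm f)"
    by (simp only: sum_const_nb nsum_cmult Nrm_def)
  also have "\<dots> \<le> C0 * epw q (of_nat (2 ^ CARD('d)) * ?v R) * ((of_nat (2 ^ CARD('d)) * ?v R) * Nrm f)"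
    by (intro mult_mono mult_left_mono mult_right_mono epw_mono q_pos vol_le_scaled) auto
  also have "\<dots> = ?v R * (avg_const CARD('d) q C0 * epw q (?v R) * Nrm f)"
    by (simp only: avg_const_def epw_mult ac_simps)
  finally show ?thesis
    using vol_nonzero vol_less_top by (subst (asm) ennreal_mult_le_mult_iff) (auto simp: less_top)
qed

text \<open>Jensen with masses \<open>a R * ?v R\<close> reduces the kernel to normalized ball
  averages. Each of these is bounded by \<open>Nrm_average_le\<close>, and the powers of the volume
  cancel, so the bound is uniform in \<open>R\<close>.\<close>

lemma Nrm_kop_le:
  assumes fin: "pnorm CARD('d) a < top"
  shows "Nrm (kop a f) \<le> avg_const CARD('d) q C0 * epw q (pnorm CARD('d) a) * Nrm f"
proof (cases "pnorm CARD('d) a = 0")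
  case True
  then have "a R = 0" for R
    using vol_nonzero unfolding pnorm_def nsum_eq_0 by auto
  then have "kop a f i = 0" for i by (simp add: kop_def)
  then show ?thesis by (simp add: Nrm_def)
next
  case False
  let ?v = "vol CARD('d)" and ?p = "pnorm CARD('d) a" and ?S = "\<lambda>i R. \<Sum>j\<in>nb i R. f j"
  have vi: "?v R * inverse (?v R) = 1" for R
    using vol_nonzero vol_less_top by (simp add: ennreal_divide_self flip: divide_ennreal_def)
  have "?p * Nrm (kop a f) = nsum (\<lambda>i. w i * (?p * epw q (nsum (\<lambda>R. (a R * ?v R) * (inverse (?v R) * ?S i R)))))"
    unfolding Nrm_def nsum_cmult[symmetric] kop_def
    by (intro nn_integral_cong) (simp add: ac_simps vi mult.assoc[symmetric, of "?v _"])
  also have "\<dots> \<le> nsum (\<lambda>i. w i * (epw q ?p * nsum (\<lambda>R. (a R * ?v R) * epw q (inverse (?v R) * ?S i R))))"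
    using fin unfolding pnorm_def by (intro nsum_mono mult_left_mono nsum_jensen q) auto
  also have "\<dots> = nsum (\<lambda>i. nsum (\<lambda>R. epw q ?p * ((a R * ?v R) * epw q (inverse (?v R))) * (w i * epw q (?S i R))))"
    unfolding epw_mult nsum_cmult[symmetric] by (simp add: ac_simps)
  also have "\<dots> = nsum (\<lambda>R. epw q ?p * ((a R * ?v R) * epw q (inverse (?v R))) * Nrm (\<lambda>i. ?S i R))"
    by (subst nsum_swap) (simp only: nsum_cmult Nrm_def)
  also have "\<dots> \<le> nsum (\<lambda>R. epw q ?p * ((a R * ?v R) * epw q (inverse (?v R))) * (avg_const CARD('d) q C0 * epw q (?v R) * Nrm f))"
    by (intro nsum_mono mult_left_mono Nrm_average_le) auto
  also have "\<dots> = nsum (\<lambda>R. (a R * ?v R) * (epw q (?v R * inverse (?v R)) * (epw q ?p * avg_const CARD('d) q C0 * Nrm f)))"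
    by (intro nn_integral_cong) (simp only: epw_mult ac_simps)
  also have "\<dots> = ?p * (epw q ?p * avg_const CARD('d) q C0 * Nrm f)"
    by (simp only: vi epw_1 mult_1_left nsum_multc pnorm_def)
  also have "\<dots> = ?p * (avg_const CARD('d) q C0 * epw q ?p * Nrm f)"
    by (simp only: ac_simps)
  finally show ?thesis
    using fin False by (subst (asm) ennreal_mult_le_mult_iff) (auto simp: less_top)
qed

end

section \<open>Matrices of the Beurling class\<close>

lemma nsum_le_if_finite_sums_le:
  fixes f :: "'a::countable \<Rightarrow> ennreal"
  assumes "\<And>F. finite F \<Longrightarrow> sum f F \<le> B" shows "nsum f \<le> B"
proof -
  define F where "F n = {x::'a. to_nat x < n}" for n
  have fin: "finite (F n)" for n
  proof (rule finite_imageD)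
    show "finite (to_nat ` F n)" by (rule finite_subset[of _ "{..<n}"]) (auto simp: F_def)
  qed (auto intro: inj_on_subset)
  define g where "g n x = (if x \<in> F n then f x else 0)" for n x
  have "(SUP n. g n x) = f x" for x
  proof (rule antisym)
    have "f x = g (Suc (to_nat x)) x" by (simp add: g_def F_def)
    then show "f x \<le> (SUP n. g n x)" by (metis SUP_upper UNIV_I)
  next
    show "(SUP n. g n x) \<le> f x" by (rule SUP_least) (simp add: g_def)
  qed
  then have "nsum f = nsum (\<lambda>x. SUP n. g n x)" by simp
  also have "\<dots> = (SUP n. nsum (g n))"
    by (rule nn_integral_monotone_convergence_SUP) (auto simp: incseq_def le_fun_def g_def F_def)
  also have "\<dots> \<le> B"
    unfolding g_def by (intro SUP_least) (simp add: sum_eq_nsum[symmetric] fin assms)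
  finally show ?thesis .
qed

lemma abs_summable_if_nsum:
  fixes f :: "'a \<Rightarrow> 'b::real_normed_vector"
  assumes "nsum (\<lambda>x. ennreal (norm (f x))) < top" shows "(\<lambda>x. norm (f x)) summable_on UNIV"
  unfolding abs_summable_iff_bdd_above
proof (rule bdd_aboveI2)
  fix F assume "F \<in> {F. F \<subseteq> (UNIV :: 'a set) \<and> finite F}"
  then have "ennreal (\<Sum>x\<in>F. norm (f x)) \<le> nsum (\<lambda>x. ennreal (norm (f x)))"
    using sum_le_nsum[of F "\<lambda>x. ennreal (norm (f x))"] by simp
  then show "(\<Sum>x\<in>F. norm (f x)) \<le> enn2real (nsum (\<lambda>x. ennreal (norm (f x))))"
    using assms by (cases "nsum (\<lambda>x. ennreal (norm (f x)))") auto
qed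

lemma infsum_le_nsum:
  fixes g :: "'a \<Rightarrow> real"
  assumes "g summable_on UNIV" "\<And>x. 0 \<le> g x"
  shows "ennreal (infsum g UNIV) \<le> nsum (\<lambda>x. ennreal (g x))"
proof -
  have "ennreal (infsum g UNIV) = (SUP F\<in>{F. finite F \<and> F \<subseteq> UNIV}. ennreal (sum g F))"
    using assms by (intro infsum_nonneg_is_SUPREMUM_ennreal) auto
  also have "\<dots> \<le> nsum (\<lambda>x. ennreal (g x))"
  proof (rule SUP_least)
    fix F assume "F \<in> {F. finite F \<and> F \<subseteq> (UNIV::'a set)}"
    then show "ennreal (sum g F) \<le> nsum (\<lambda>x. ennreal (g x))"
      using sum_le_nsum[of F "\<lambda>x. ennreal (g x)"] assms by simp
  qed
  finally show ?thesis .
qed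

lemma norm_infsum_le_nsum:
  fixes f :: "'a \<Rightarrow> 'b::banach"
  shows "ennreal (norm (infsum f UNIV)) \<le> nsum (\<lambda>x. ennreal (norm (f x)))"
proof (cases "nsum (\<lambda>x. ennreal (norm (f x))) < top")
  case True
  then have *: "(\<lambda>x. norm (f x)) summable_on UNIV" by (rule abs_summable_if_nsum)
  have "ennreal (norm (infsum f UNIV)) \<le> ennreal (\<Sum>\<^sub>\<infinity>x. norm (f x))"
    by (intro ennreal_leI norm_infsum_bound *)
  also have "\<dots> \<le> nsum (\<lambda>x. ennreal (norm (f x)))"
    using * by (intro infsum_le_nsum) auto
  finally show ?thesis .
qed (auto simp: less_top[symmetric])

lemma nsum_eq_infsum:
  fixes g :: "'a::countable \<Rightarrow> real"
  assumes "g summable_on UNIV" "\<And>x. 0 \<le> g x"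
  shows "nsum (\<lambda>x. ennreal (g x)) = ennreal (infsum g UNIV)"
proof (rule antisym)
  show "nsum (\<lambda>x. ennreal (g x)) \<le> ennreal (infsum g UNIV)"
    using assms by (intro nsum_le_if_finite_sums_le) (auto intro!: ennreal_leI finite_sum_le_infsum)
qed (rule infsum_le_nsum[OF assms])

lemma summable_on_iff_nsum:
  fixes g :: "'a::countable \<Rightarrow> real"
  assumes "\<And>x. 0 \<le> g x"
  shows "g summable_on UNIV \<longleftrightarrow> nsum (\<lambda>x. ennreal (g x)) < top"
proof
  assume "nsum (\<lambda>x. ennreal (g x)) < top"
  then have "(\<lambda>x. norm (g x)) summable_on UNIV" using assms by (intro abs_summable_if_nsum) simp
  then show "g summable_on UNIV" by (rule abs_summable_summable)
qed (use assms in \<open>simp add: nsum_eq_infsum\<close>)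

lemma infsum_swap_nsum:
  fixes F :: "'a \<Rightarrow> 'b \<Rightarrow> 'c::banach"
  assumes "nsum (\<lambda>x. nsum (\<lambda>y. ennreal (norm (F x y)))) < top"
  shows "(\<Sum>\<^sub>\<infinity>x. \<Sum>\<^sub>\<infinity>y. F x y) = (\<Sum>\<^sub>\<infinity>y. \<Sum>\<^sub>\<infinity>x. F x y)"
proof (rule infsum_swap_banach)
  have "(\<lambda>p. norm (case p of (x, y) \<Rightarrow> F x y)) summable_on UNIV"
    using assms by (intro abs_summable_if_nsum) (simp add: nsum_prod[symmetric] case_prod_beta)
  then show "(\<lambda>(x, y). F x y) summable_on UNIV \<times> UNIV"
    by (simp add: abs_summable_summable)
qed

section \<open>Action, product and adjoint of dominated matrices\<close>

abbreviation cn :: "('a \<Rightarrow> complex) \<Rightarrow> 'a \<Rightarrow> ennreal" where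
  "cn c \<equiv> \<lambda>i. ennreal (cmod (c i))"

text \<open>Together with \<open>pnorm CARD('d) a < top\<close> this is the working form of
  membership in the Beurling class: a radially decreasing summable kernel bounds the
  entries.\<close>

definition dominated :: "(nat \<Rightarrow> ennreal) \<Rightarrow> 'd::finite inf_matrix \<Rightarrow> bool" where
  "dominated a A \<longleftrightarrow> (\<forall>i j. ennreal (cmod (A i j)) \<le> kern a (i - j))"

lemma dominatedD: "dominated a A \<Longrightarrow> ennreal (cmod (A i j)) \<le> kern a (i - j)"
  by (simp add: dominated_def)

lemma row_sum_le_kop:
  assumes "dominated a A" shows "nsum (\<lambda>j. ennreal (cmod (A i j * c j))) \<le> kop a (cn c) i"
  unfolding kop_kern[symmetric] using assms
  by (intro nsum_mono) (simp add: norm_mult ennreal_mult mult_right_mono dominatedD)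

lemma mat_app_le_kop:
  assumes "dominated a A" shows "cn (mat_app A c) i \<le> kop a (cn c) i"
  using norm_infsum_le_nsum[of "\<lambda>j. A i j * c j"] row_sum_le_kop[OF assms, of i c]
  unfolding mat_app_def by (rule order_trans)

lemma row_abs_summable:
  assumes "dominated a A" "kop a (cn c) i < top" shows "(\<lambda>j. norm (A i j * c j)) summable_on UNIV"
  using row_sum_le_kop[OF assms(1), of i c] assms(2) by (intro abs_summable_if_nsum) (rule le_less_trans)

lemma mat_app_add:
  assumes "dominated a A" "kop a (cn c) i < top" "kop a (cn c') i < top"
  shows "mat_app A (\<lambda>j. c j + c' j) i = mat_app A c i + mat_app A c' i"
  unfolding mat_app_def distrib_left
  by (intro infsum_add abs_summable_summable[OF row_abs_summable[OF assms(1)]] assms)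

lemma mat_app_cmult: "mat_app A (\<lambda>j. z * c j) i = z * mat_app A c i"
proof -
  have "A i j * (z * c j) = z * (A i j * c j)" for j by simp
  then show ?thesis unfolding mat_app_def by (simp only: infsum_cmult_right')
qed

lemma mat_app_diff:
  assumes "dominated a A" "kop a (cn c) i < top" "kop a (cn c') i < top"
  shows "mat_app A (\<lambda>j. c j - c' j) i = mat_app A c i - mat_app A c' i"
  using mat_app_add[OF assms(1,2), of "\<lambda>j. - 1 * c' j"] assms(3)
  by (simp only: mat_app_cmult) simp

definition mat_mul :: "'d::finite inf_matrix \<Rightarrow> 'd inf_matrix \<Rightarrow> 'd inf_matrix" where
  "mat_mul A B i j = mat_app A (\<lambda>l. B l j) i"

lemma dominated_mat_mul:
  fixes A B :: "'d::finite inf_matrix"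
  assumes "dominated a A" "dominated b B"
  shows "dominated (pconv CARD('d) a b) (mat_mul A B)"
  unfolding dominated_def mat_mul_def
proof (intro allI)
  fix i j
  have "cn (mat_app A (\<lambda>l. B l j)) i \<le> kop a (cn (\<lambda>l. B l j)) i"
    by (rule mat_app_le_kop[OF assms(1)])
  also have "\<dots> \<le> kop a (\<lambda>l. kern b (l - j)) i"
    by (intro kop_mono dominatedD assms)
  also have "\<dots> \<le> kern (pconv CARD('d) a b) (i - j)"
    unfolding kop_kern[symmetric] by (rule kern_conv_le)
  finally show "ennreal (cmod (mat_app A (\<lambda>l. B l j) i)) \<le> kern (pconv CARD('d) a b) (i - j)" .
qed

text \<open>Associativity is Fubini; finiteness of the iterated kernel sum is the absolute
  convergence it requires.\<close>

lemma mat_app_mat_app: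
  assumes "dominated a A" "dominated b B" "kop a (kop b (cn c)) i < top"
  shows "mat_app A (mat_app B c) i = mat_app (mat_mul A B) c i"
proof -
  have "mat_app A (mat_app B c) i = (\<Sum>\<^sub>\<infinity>l. \<Sum>\<^sub>\<infinity>j. A i l * (B l j * c j))"
    unfolding mat_app_def by (simp only: infsum_cmult_right')
  also have "\<dots> = (\<Sum>\<^sub>\<infinity>j. \<Sum>\<^sub>\<infinity>l. A i l * (B l j * c j))"
  proof (rule infsum_swap_nsum)
    have "nsum (\<lambda>l. nsum (\<lambda>j. ennreal (norm (A i l * (B l j * c j)))))
        = nsum (\<lambda>l. ennreal (cmod (A i l)) * nsum (\<lambda>j. ennreal (cmod (B l j * c j))))"
      by (simp add: norm_mult[of "A i _"] ennreal_mult nsum_cmult)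
    also have "\<dots> \<le> nsum (\<lambda>l. kern a (i - l) * kop b (cn c) l)"
      by (intro nsum_mono mult_mono dominatedD assms row_sum_le_kop) auto
    finally show "nsum (\<lambda>l. nsum (\<lambda>j. ennreal (norm (A i l * (B l j * c j))))) < top"
      using assms(3) unfolding kop_kern by (rule le_less_trans)
  qed
  also have "\<dots> = mat_app (mat_mul A B) c i"
    unfolding mat_app_def mat_mul_def by (simp only: infsum_cmult_left' mult.assoc[symmetric])
  finally show ?thesis .
qed

definition adj :: "'d::finite inf_matrix \<Rightarrow> 'd inf_matrix" where
  "adj A i j = cnj (A j i)"

lemma dominated_adj: "dominated a A \<Longrightarrow> dominated a (adj A)"
  by (simp add: dominated_def adj_def) (metis kern_commute)

text \<open>Abel summation: the decreasing majorant \<open>h\<close> of the entries is rebuilt from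
  its differences \<open>h R - h (Suc R)\<close>, whose tail sums telescope. Nothing is lost at
  infinity because \<open>h\<close> tends to 0.\<close>

lemma B_class_dominated:
  fixes A :: "'d::finite inf_matrix"
  assumes "A \<in> B_class"
  obtains a where "pnorm CARD('d) a < top" "dominated a A"
proof -
  define h where "h r = (SUP (i, j) \<in> {(i, j). supnorm (i - j) \<ge> int r}. ennreal (cmod (A i j)))" for r
  let ?h = "\<lambda>k :: int ^ 'd. h (nat (supnorm k))"
  have anti: "h s \<le> h r" if "r \<le> s" for r s
    unfolding h_def using that by (intro SUP_subset_mono) auto
  have B: "B_norm A = (\<Sum>\<^sub>\<infinity>k\<in>UNIV. ?h k)"
    unfolding B_norm_def h_def by (simp add: supnorm_nonneg)
  then have "nsum ?h \<le> B_norm A"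
    by (intro nsum_le_if_finite_sums_le) (auto simp: nonneg_infsum_complete intro!: SUP_upper)
  moreover have "B_norm A < top" using assms by (simp add: B_class_def)
  ultimately have fin: "nsum ?h < top" by (rule le_less_trans)
  \<comment> \<open>\<open>h\<close> is at least \<open>h r\<close> on the whole ball of radius
    \<open>r\<close>, and that ball has at least \<open>r\<close> points.\<close>
  have decay: "of_nat r * h r \<le> nsum ?h" for r
  proof -
    have "of_nat r * h r \<le> vol CARD('d) r * h r"
    proof (intro mult_right_mono)
      have "r \<le> (2 * r + 1) ^ 1" by simp
      also have "\<dots> \<le> (2 * r + 1) ^ CARD('d)" by (intro power_increasing) (auto simp: Suc_le_eq)
      finally show "of_nat r \<le> vol CARD('d) r" unfolding vol_def by (rule of_nat_mono)
    qed simp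
    also have "\<dots> = (\<Sum>k\<in>nb (0 :: int ^ 'd) r. h r)" by (simp only: sum_const_nb)
    also have "\<dots> \<le> (\<Sum>k\<in>nb (0 :: int ^ 'd) r. ?h k)"
      by (intro sum_mono anti) (simp add: nb_def nat_le_iff)
    also have "\<dots> \<le> nsum ?h" by (rule sum_le_nsum) simp
    finally show ?thesis .
  qed
  define a where "a R = h R - h (Suc R)" for R
  \<comment> \<open>Stated as a sum because subtraction in \<open>ennreal\<close> is truncated;
    monotonicity of \<open>h\<close> makes each difference exact.\<close>
  have tele: "(\<Sum>R\<in>{r..<n}. a R) + h n = h r" if "r \<le> n" for r n
    using that
  proof (induction n rule: dec_induct)
    case (step n)
    have "a n + h (Suc n) = h n"
      unfolding a_def by (rule diff_add_cancel_ennreal) (simp add: anti)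
    then show ?case using step by (simp add: add.assoc)
  qed simp
  have upper: "kern a k \<le> ?h k" for k :: "int ^ 'd"
    unfolding kern_def
  proof (rule nsum_le_if_finite_sums_le)
    fix F :: "nat set" assume "finite F"
    then obtain n where n: "F \<subseteq> {..<n}" by (metis finite_nat_bounded)
    let ?r = "nat (supnorm k)" and ?m = "max n (nat (supnorm k))"
    have "(\<Sum>R\<in>F. a R * of_bool (supnorm k \<le> int R)) = (\<Sum>R\<in>{R\<in>F. supnorm k \<le> int R}. a R)"
      using \<open>finite F\<close> by (simp add: of_bool_def sum.inter_filter if_distrib cong: if_cong)
    also have "\<dots> \<le> (\<Sum>R\<in>{?r..<?m}. a R)"
      using n by (intro sum_mono2) auto
    also have "\<dots> \<le> (\<Sum>R\<in>{?r..<?m}. a R) + h ?m" by simp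
    also have "\<dots> = h ?r" by (rule tele) simp
    finally show "(\<Sum>R\<in>F. a R * of_bool (supnorm k \<le> int R)) \<le> h ?r" .
  qed
  have lower: "h (nat (supnorm k)) \<le> kern a k" for k :: "int ^ 'd"
  proof (rule ennreal_le_epsilon)
    fix e :: real assume "0 < e"
    \<comment> \<open>From this \<open>n\<close> on, \<open>decay\<close> forces \<open>h\<close>
      below \<open>e\<close>, so the tail omitted from the telescoping sum is at most
      \<open>e\<close>.\<close>
    obtain n where n: "nsum ?h / ennreal e < of_nat n"
      using ennreal_Ex_less_of_nat[of "nsum ?h / ennreal e"] fin \<open>0 < e\<close>
      by (auto simp: ennreal_divide_eq_top_iff less_top[symmetric])
    let ?r = "nat (supnorm k)" and ?m = "max n (nat (supnorm k))"
    have "h ?m \<le> ennreal e"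
    proof (rule ccontr)
      assume "\<not> h ?m \<le> ennreal e"
      then have "of_nat n * ennreal e \<le> of_nat ?m * h ?m" by (intro mult_mono of_nat_mono) auto
      also have "\<dots> \<le> nsum ?h" by (rule decay)
      also have "\<dots> < of_nat n * ennreal e"
        using n \<open>0 < e\<close> by (subst (asm) divide_less_ennreal) auto
      finally show False by simp
    qed
    moreover have "(\<Sum>R\<in>{?r..<?m}. a R) \<le> kern a k"
    proof -
      have "(\<Sum>R\<in>{?r..<?m}. a R) = (\<Sum>R\<in>{?r..<?m}. a R * of_bool (supnorm k \<le> int R))"
        by (intro sum.cong) auto
      also have "\<dots> \<le> kern a k" unfolding kern_def by (rule sum_le_nsum) simp
      finally show ?thesis .
    qed
    ultimately have "(\<Sum>R\<in>{?r..<?m}. a R) + h ?m \<le> kern a k + ennreal e" by (rule add_mono[rotated])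
    then show "h ?r \<le> kern a k + ennreal e" by (simp add: tele)
  qed
  have "dominated a A"
    unfolding dominated_def
  proof (intro allI)
    fix i j
    have "ennreal (cmod (A i j)) \<le> h (nat (supnorm (i - j)))"
      unfolding h_def by (rule SUP_upper2[of "(i, j)"]) (auto simp: supnorm_nonneg)
    then show "ennreal (cmod (A i j)) \<le> kern a (i - j)" using lower by (rule order_trans)
  qed
  moreover have "pnorm CARD('d) a \<le> nsum ?h"
  proof -
    have "pnorm CARD('d) a = kop a (\<lambda>_. 1) (0 :: int ^ 'd)" by (simp add: kop_const)
    also have "\<dots> = nsum (\<lambda>j :: int ^ 'd. kern a j)"
      unfolding kop_kern[symmetric] kern_commute[of a 0] by simp
    also have "\<dots> \<le> nsum ?h" by (intro nsum_mono upper)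
    finally show ?thesis .
  qed
  ultimately show ?thesis using that fin by (meson le_less_trans)
qed

section \<open>Neumann series, grids and cutoffs\<close>

primrec ppow :: "nat \<Rightarrow> (nat \<Rightarrow> ennreal) \<Rightarrow> nat \<Rightarrow> nat \<Rightarrow> ennreal" where
  "ppow d v 0 = (\<lambda>n. if n = 0 then 1 else 0)"
| "ppow d v (Suc k) = pconv d v (ppow d v k)"

lemma pnorm_ppow_le: "pnorm d (ppow d v k) \<le> (2 ^ d * pnorm d v) ^ k"
proof (induction k)
  case 0
  have "pnorm d (ppow d v 0) = nsum (\<lambda>R. if R = 0 then vol d R else 0)"
    unfolding pnorm_def ppow.simps by (intro nn_integral_cong) auto
  then show ?case by (simp add: nsum_delta)
next
  case (Suc k)
  have "pnorm d (ppow d v (Suc k)) \<le> 2 ^ d * pnorm d v * pnorm d (ppow d v k)"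
    by (simp add: pnorm_pconv_le)
  also have "\<dots> \<le> 2 ^ d * pnorm d v * (2 ^ d * pnorm d v) ^ k"
    by (intro mult_left_mono Suc.IH) simp
  finally show ?case by simp
qed

text \<open>All mass at radius 0 means convolution with a unit point mass, since
  \<open>nb i 0\<close> is a single point.\<close>

lemma kop_ppow_0: "kop (ppow d v 0) f i = f i"
proof -
  have "kop (ppow d v 0) f i = nsum (\<lambda>R. if R = 0 then \<Sum>j\<in>nb i R. f j else 0)"
    unfolding kop_def ppow.simps by (intro nn_integral_cong) auto
  then show ?thesis by (simp add: nsum_delta)
qed

lemma kop_sum: "finite S \<Longrightarrow> kop a (\<lambda>j. \<Sum>k\<in>S. f k j) i = (\<Sum>k\<in>S. kop a (f k) i)"
  by (induction S rule: finite_induct) (simp_all add: kop_add, simp add: kop_def)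

text \<open>Iterating \<open>u \<le> \<alpha> + kop v u\<close> gives partial sums of the Neumann
  series plus a remainder \<open>(1/2) ^ n * U\<close>; the a priori bound \<open>U\<close> makes it
  vanish. The factor \<open>2 ^ CARD('d)\<close> pays for \<open>pnorm_pconv_le\<close>. The profile
  is fixed before \<open>u\<close> and \<open>\<alpha>\<close>, so it serves all sequences.\<close>

lemma neumann_profile:
  fixes v :: "nat \<Rightarrow> ennreal"
  assumes small: "2 ^ CARD('d) * pnorm CARD('d) v \<le> ennreal (1/2)"
  obtains \<omega> where "pnorm CARD('d) \<omega> < top"
    "\<forall>(u :: int ^ 'd::finite \<Rightarrow> ennreal) \<alpha> U. U < top \<and> (\<forall>m. u m \<le> U \<and> u m \<le> \<alpha> m + kop v u m) \<longrightarrow> (\<forall>m. u m \<le> kop \<omega> \<alpha> m)"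
proof
  let ?d = "CARD('d)"
  define \<omega> where "\<omega> R = nsum (\<lambda>k. ppow ?d v k R)" for R
  have "pnorm ?d \<omega> = nsum (\<lambda>k. pnorm ?d (ppow ?d v k))"
    unfolding pnorm_def \<omega>_def nsum_multc[symmetric] by (rule nsum_swap)
  also have "\<dots> \<le> nsum (\<lambda>k. ennreal ((1/2) ^ k))"
  proof (rule nsum_mono)
    fix k
    have "pnorm ?d (ppow ?d v k) \<le> (2 ^ ?d * pnorm ?d v) ^ k" by (rule pnorm_ppow_le)
    also have "\<dots> \<le> ennreal (1/2) ^ k" by (rule power_mono_ennreal[OF small])
    also have "\<dots> = ennreal ((1/2) ^ k)" by (rule ennreal_power) simp
    finally show "pnorm ?d (ppow ?d v k) \<le> ennreal ((1/2) ^ k)" .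
  qed
  also have "\<dots> < top"
    unfolding nn_integral_count_space_nat less_top[symmetric]
    by (rule ennreal_suminf_neq_top) (auto intro: summable_geometric)
  finally show "pnorm ?d \<omega> < top" .
  show "\<forall>(u :: int ^ 'd \<Rightarrow> ennreal) \<alpha> U. U < top \<and> (\<forall>m. u m \<le> U \<and> u m \<le> \<alpha> m + kop v u m) \<longrightarrow> (\<forall>m. u m \<le> kop \<omega> \<alpha> m)"
  proof (intro allI impI, elim conjE)
    fix u :: "int ^ 'd \<Rightarrow> ennreal" and \<alpha> U m
    assume U': "U < top" "\<forall>m. u m \<le> U \<and> u m \<le> \<alpha> m + kop v u m"
    then have U: "U < top" "\<And>m. u m \<le> U" and rec: "\<And>m. u m \<le> \<alpha> m + kop v u m" by auto
    have v: "pnorm ?d v \<le> ennreal (1/2)"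
    proof -
      have "1 * pnorm ?d v \<le> 2 ^ ?d * pnorm ?d v" by (intro mult_right_mono) auto
      then show ?thesis using small by simp
    qed
    have it: "u m \<le> (\<Sum>k<n. kop (ppow ?d v k) \<alpha> m) + ennreal ((1/2) ^ n) * U" for n m
    proof (induction n arbitrary: m)
      case 0
      then show ?case using U by simp
    next
      case (Suc n)
      have "kop v u m \<le> kop v (\<lambda>m. (\<Sum>k<n. kop (ppow ?d v k) \<alpha> m) + ennreal ((1/2) ^ n) * U) m"
        by (rule kop_mono) (rule Suc.IH)
      also have "\<dots> = (\<Sum>k<n. kop v (kop (ppow ?d v k) \<alpha>) m) + pnorm ?d v * (ennreal ((1/2) ^ n) * U)"
        by (simp only: kop_add kop_sum finite_lessThan kop_const)
      also have "\<dots> \<le> (\<Sum>k<n. kop (ppow ?d v (Suc k)) \<alpha> m) + ennreal (1/2) * (ennreal ((1/2) ^ n) * U)"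
        unfolding ppow.simps by (intro add_mono sum_mono kop_kop_le mult_right_mono v) simp
      finally have "kop v u m \<le> (\<Sum>k<n. kop (ppow ?d v (Suc k)) \<alpha> m) + ennreal ((1/2) ^ Suc n) * U"
        using ennreal_mult[of "1/2" "(1/2) ^ n"] by (simp only: mult.assoc[symmetric] power_Suc) simp
      then have "\<alpha> m + kop v u m \<le> \<alpha> m + ((\<Sum>k<n. kop (ppow ?d v (Suc k)) \<alpha> m) + ennreal ((1/2) ^ Suc n) * U)"
        by (rule add_left_mono)
      also have "\<dots> = (\<Sum>k<Suc n. kop (ppow ?d v k) \<alpha> m) + ennreal ((1/2) ^ Suc n) * U"
        by (simp only: sum.lessThan_Suc_shift kop_ppow_0 add.assoc)
      finally show ?case using rec[of m] by (rule order_trans[rotated])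
    qed
    have bound: "u m \<le> kop \<omega> \<alpha> m + ennreal ((1/2) ^ n) * U" for n
    proof -
      have "(\<Sum>k<n. kop (ppow ?d v k) \<alpha> m) \<le> nsum (\<lambda>k. kop (ppow ?d v k) \<alpha> m)"
        by (rule sum_le_nsum) simp
      also have "\<dots> = kop \<omega> \<alpha> m"
        unfolding kop_def \<omega>_def nsum_multc[symmetric] by (rule nsum_swap)
      finally show ?thesis using it[of m n] by (meson add_right_mono order_trans)
    qed
    have "(\<lambda>n. ennreal ((1/2) ^ n) * U) \<longlonglongrightarrow> ennreal 0 * U"
      using U by (intro tendsto_mult_ennreal tendsto_ennrealI LIMSEQ_power_zero tendsto_const) (auto simp: less_top)
    then have "(\<lambda>n. kop \<omega> \<alpha> m + ennreal ((1/2) ^ n) * U) \<longlonglongrightarrow> kop \<omega> \<alpha> m + ennreal 0 * U"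
      by (intro tendsto_add tendsto_const)
    then show "u m \<le> kop \<omega> \<alpha> m"
      using bound by (intro LIMSEQ_le_const[of _ "kop \<omega> \<alpha> m"]) auto
  qed
qed

section \<open>The grid of mesh \<open>N\<close> and its overlapping cells\<close>

definition ctr :: "nat \<Rightarrow> int ^ 'd::finite \<Rightarrow> int ^ 'd" where
  "ctr N m = (\<chi> n. int N * m $ n)"

definition gdiv :: "nat \<Rightarrow> int ^ 'd::finite \<Rightarrow> int ^ 'd" where
  "gdiv N i = (\<chi> n. i $ n div int N)"

text \<open>Passing to the grid divides distances by \<open>N\<close>; rounding down can cost one
  more step on the negative side, hence the \<open>+ 1\<close>.\<close>

lemma gdiv_mem_nb:
  assumes "1 \<le> N" "i \<in> nb (ctr N m) T" shows "gdiv N i \<in> nb m (T div N + 1)"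
  unfolding mem_nb
proof
  fix n
  define x where "x = i $ n - int N * m $ n"
  have x: "- int T \<le> x" "x \<le> int T"
    using assms(2) by (auto simp: mem_nb ctr_def x_def abs_le_iff dest: spec[of _ n])
  have "i $ n = x + int N * m $ n" by (simp add: x_def)
  then have eq: "i $ n div int N - m $ n = x div int N"
    using assms(1) by simp
  have "x div int N \<le> int T div int N"
    using x assms(1) by (intro zdiv_mono1) auto
  moreover have "- (int T div int N) - 1 \<le> x div int N"
  proof -
    have "- (int T div int N) - 1 \<le> (- int T) div int N"
      using assms(1) by (simp add: zdiv_zminus1_eq_if)
    also have "\<dots> \<le> x div int N"
      using x assms(1) by (intro zdiv_mono1) auto
    finally show ?thesis .
  qed
  ultimately show "\<bar>gdiv N i $ n - m $ n\<bar> \<le> int (T div N + 1)"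
    by (simp add: gdiv_def eq zdiv_int abs_le_iff)
qed

lemma mem_nb_ctr_gdiv:
  assumes "1 \<le> N" shows "i \<in> nb (ctr N (gdiv N i)) N"
  unfolding mem_nb
proof
  fix n
  have "i $ n - int N * (i $ n div int N) = i $ n mod int N"
    by (simp add: minus_mult_div_eq_mod)
  moreover have "0 \<le> i $ n mod int N" "i $ n mod int N \<le> int N"
    using assms by (auto intro: less_imp_le)
  ultimately show "\<bar>i $ n - ctr N (gdiv N i) $ n\<bar> \<le> int N"
    by (simp add: ctr_def gdiv_def)
qed

lemma ctr_mem_nb:
  assumes "n \<in> nb m R" shows "ctr N n \<in> nb (ctr N m) (N * R)"
  using assms unfolding mem_nb ctr_def
  by (simp add: right_diff_distrib[symmetric] abs_mult mult_left_mono)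

lemma sum_cover_le:
  fixes g :: "'a \<Rightarrow> ennreal"
  assumes "finite S" "finite M" "\<And>n. n \<in> M \<Longrightarrow> finite (B n)" "S \<subseteq> (\<Union>n\<in>M. B n)"
  shows "sum g S \<le> (\<Sum>n\<in>M. sum g (B n))"
proof -
  have "sum g S \<le> sum g (\<Union>n\<in>M. B n)" using assms by (intro sum_mono2) auto
  also have "\<dots> \<le> (\<Sum>n\<in>M. sum g (B n))"
    using assms(2,3)
  proof (induction M rule: finite_induct)
    case (insert m M)
    have "sum g (B m \<union> (\<Union>n\<in>M. B n)) \<le> sum g (B m) + sum g (\<Union>n\<in>M. B n)"
      using insert by (subst sum.union_inter[symmetric]) (auto intro: add_increasing2)
    also have "\<dots> \<le> sum g (B m) + (\<Sum>n\<in>M. sum g (B n))"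
      using insert by (intro add_left_mono) auto
    finally show ?case using insert by simp
  qed simp
  finally show ?thesis .
qed

lemma sum_nb_ctr_le:
  assumes "1 \<le> N"
  shows "sum g (nb (ctr N m) T) \<le> (\<Sum>n\<in>nb m (T div N + 1). sum g (nb (ctr N n) N) :: ennreal)"
proof (rule sum_cover_le)
  show "nb (ctr N m) T \<subseteq> (\<Union>n\<in>nb m (T div N + 1). nb (ctr N n) N)"
  proof
    fix i assume "i \<in> nb (ctr N m) T"
    then show "i \<in> (\<Union>n\<in>nb m (T div N + 1). nb (ctr N n) N)"
      by (intro UN_I[of "gdiv N i"] gdiv_mem_nb mem_nb_ctr_gdiv assms)
  qed
qed simp_all

text \<open>A plateau of radius \<open>N\<close>, then a linear descent to 0 at radius
  \<open>2 * N\<close>. The slope \<open>1 / N\<close> is what makes the commutator small.\<close>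

definition cutoff :: "nat \<Rightarrow> int ^ 'd::finite \<Rightarrow> int ^ 'd \<Rightarrow> real" where
  "cutoff N x i = max 0 (min 1 (2 - real_of_int (supnorm (i - x)) / real N))"

lemma cutoff_range: "0 \<le> cutoff N x i" "cutoff N x i \<le> 1"
  by (auto simp: cutoff_def)

lemma cutoff_eq_1:
  assumes "1 \<le> N" "i \<in> nb x N" shows "cutoff N x i = 1"
proof -
  have "real_of_int (supnorm (i - x)) \<le> real N" using assms(2) by (simp add: nb_def)
  then have "real_of_int (supnorm (i - x)) / real N \<le> 1" using assms(1) by simp
  then show ?thesis unfolding cutoff_def by linarith
qed

lemma cutoff_eq_0:
  assumes "1 \<le> N" "i \<notin> nb x (2 * N)" shows "cutoff N x i = 0"
proof -
  have "2 * real N \<le> real_of_int (supnorm (i - x))" using assms(2) by (simp add: nb_def)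
  then have "2 \<le> real_of_int (supnorm (i - x)) / real N" using assms(1) by (simp add: le_divide_eq)
  then show ?thesis unfolding cutoff_def by linarith
qed

lemma cutoff_diff_le:
  assumes "1 \<le> N" "j \<in> nb i R" shows "\<bar>cutoff N x j - cutoff N x i\<bar> \<le> min 1 (real R / real N)"
proof -
  have "supnorm (j - x) \<le> supnorm (j - i) + supnorm (i - x)" "supnorm (i - x) \<le> supnorm (i - j) + supnorm (j - x)"
    using supnorm_triangle[of "j - i" "i - x"] supnorm_triangle[of "i - j" "j - x"] by simp_all
  then have "\<bar>supnorm (j - x) - supnorm (i - x)\<bar> \<le> int R"
    using assms(2) supnorm_minus_commute[of i j] by (simp add: nb_def)
  then have "\<bar>real_of_int (supnorm (j - x)) - real_of_int (supnorm (i - x))\<bar> \<le> real R" by linarith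
  then have "\<bar>real_of_int (supnorm (j - x)) - real_of_int (supnorm (i - x))\<bar> / real N \<le> real R / real N"
    by (rule divide_right_mono) simp
  then have "\<bar>real_of_int (supnorm (j - x)) / real N - real_of_int (supnorm (i - x)) / real N\<bar> \<le> real R / real N"
    by (simp add: diff_divide_distrib[symmetric])
  then show ?thesis unfolding cutoff_def by linarith
qed

text \<open>Over a range \<open>R\<close> the cutoff changes by at most
  \<open>min 1 (R / N)\<close>, so this profile dominates the commutator.\<close>

definition damp :: "(nat \<Rightarrow> ennreal) \<Rightarrow> nat \<Rightarrow> nat \<Rightarrow> ennreal" where
  "damp a N R = a R * ennreal (min 1 (real R / real N))"

lemma damp_le: "damp a N R \<le> a R"
proof -
  have "a R * ennreal (min 1 (real R / real N)) \<le> a R * 1"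
    by (intro mult_left_mono) auto
  then show ?thesis by (simp add: damp_def)
qed

lemma pnorm_damp_le: "pnorm d (damp a N) \<le> pnorm d a"
  unfolding pnorm_def by (intro nsum_mono mult_right_mono damp_le) simp

text \<open>Dominated convergence: each term tends to 0 as \<open>N\<close> grows and stays below
  \<open>a R * vol d R\<close>.\<close>

lemma pnorm_damp_small:
  assumes "pnorm d a < top" "0 < e"
  obtains N where "1 \<le> N" "pnorm d (damp a N) \<le> e"
proof -
  have afin: "a R < top" for R
  proof -
    have "a R * vol d R \<le> pnorm d a" unfolding pnorm_def by (rule le_nsum)
    then have "a R * vol d R < top" using assms(1) by (rule le_less_trans)
    then show ?thesis using vol_nonzero[of d R] by (auto simp: less_top[symmetric] ennreal_mult_eq_top_iff)
  qed
  have "(\<lambda>N. nsum (\<lambda>R. damp a N R * vol d R)) \<longlonglongrightarrow> nsum (\<lambda>R::nat. 0)"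
  proof (rule nn_integral_dominated_convergence[where w="\<lambda>R. a R * vol d R"])
    show "AE R in count_space UNIV. damp a N R * vol d R \<le> a R * vol d R" for N
      by (intro AE_I2 mult_right_mono damp_le) simp
    show "AE R in count_space UNIV. (\<lambda>N. damp a N R * vol d R) \<longlonglongrightarrow> 0"
    proof (intro AE_I2)
      fix R :: nat
      have "(\<lambda>N. real R / real N) \<longlonglongrightarrow> 0" by (rule lim_const_over_n)
      then have "(\<lambda>N. min 1 (real R / real N)) \<longlonglongrightarrow> min 1 0" by (intro tendsto_min tendsto_const)
      then have "(\<lambda>N. ennreal (min 1 (real R / real N))) \<longlonglongrightarrow> ennreal (min 1 0)" by (rule tendsto_ennrealI)
      then have "(\<lambda>N. (a R * vol d R) * ennreal (min 1 (real R / real N))) \<longlonglongrightarrow> (a R * vol d R) * ennreal (min 1 0)"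
        using afin[of R] vol_less_top[of d R]
        by (intro ennreal_tendsto_cmult) (auto simp: ennreal_mult_less_top)
      then show "(\<lambda>N. damp a N R * vol d R) \<longlonglongrightarrow> 0" by (simp add: damp_def ac_simps)
    qed
  qed (use assms in \<open>auto simp: pnorm_def\<close>)
  then have "\<forall>\<^sub>F N in sequentially. pnorm d (damp a N) < e"
    using assms(2) unfolding pnorm_def by (intro order_tendstoD) auto
  then have "\<forall>\<^sub>F N in sequentially. pnorm d (damp a N) < e \<and> 1 \<le> N"
    using eventually_ge_at_top by (rule eventually_conj)
  then obtain N where "pnorm d (damp a N) < e" "1 \<le> N"
    by (auto dest!: eventually_happens)
  then show ?thesis using that by auto
qed

text \<open>The value at \<open>i\<close> is \<open>cutoff N x i\<close> times that of
  \<open>mat_app A c\<close> plus the commutator, whose entries vanish unless \<open>i\<close> or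
  \<open>j\<close> is within \<open>2 * N\<close> of \<open>x\<close>. A range
  \<open>R \<le> N\<close>, or an \<open>i\<close> outside that ball, places \<open>j\<close> within
  \<open>3 * N\<close>. For \<open>R > N\<close> and \<open>i\<close> inside, the sum is enlarged to
  a ball around \<open>x\<close>, which makes the bound independent of \<open>i\<close>.\<close>

lemma commutator_le:
  fixes x :: "int ^ 'd::finite"
  assumes A: "dominated a A" "pnorm CARD('d) a < top" and N: "1 \<le> N"
    and c: "\<And>i. cn c i \<le> F" "F < top"
  shows "cn (mat_app A (\<lambda>j. of_real (cutoff N x j) * c j)) i
    \<le> (if i \<in> nb x (2 * N) then cn (mat_app A c) i else 0)
      + (kop (damp a N) (\<lambda>j. if j \<in> nb x (3 * N) then cn c j else 0) i
      + (if i \<in> nb x (2 * N) then nsum (\<lambda>R. (if N < R then damp a N R else 0) * sum (cn c) (nb x (R + 2 * N))) else 0))"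
proof -
  let ?\<psi> = "cutoff N x" and ?b = "damp a N"
  \<comment> \<open>Records that one of the two points must meet the support of the cutoff.\<close>
  let ?g = "\<lambda>j. if i \<in> nb x (2 * N) \<or> j \<in> nb x (2 * N) then cn c j else 0"
  have kfin: "kop a (cn c') i < top" if "\<And>i. cn c' i \<le> F" for c'
  proof -
    have "kop a (cn c') i \<le> kop a (\<lambda>_. F) i" by (rule kop_mono) (rule that)
    also have "\<dots> < top" using A c by (simp add: kop_const ennreal_mult_less_top)
    finally show ?thesis .
  qed
  have cut: "cn (\<lambda>j. of_real (?\<psi> l) * c j) i \<le> F" "cn (\<lambda>j. of_real (?\<psi> j) * c j) i \<le> F" for l i
  proof -
    have "cmod (of_real (?\<psi> k) * c i) \<le> cmod (c i)" for k
      by (simp add: norm_mult mult_left_le_one_le cutoff_range)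
    then show "cn (\<lambda>j. of_real (?\<psi> l) * c j) i \<le> F" "cn (\<lambda>j. of_real (?\<psi> j) * c j) i \<le> F"
      using c(1)[of i] by (meson ennreal_leI order_trans)+
  qed
  \<comment> \<open>The commutator at \<open>i\<close>: the number \<open>?\<psi> i\<close> is
    frozen while \<open>j\<close> varies.\<close>
  define z where "z = mat_app A (\<lambda>j. of_real (?\<psi> j) * c j - of_real (?\<psi> i) * c j) i"
  have "z = mat_app A (\<lambda>j. of_real (?\<psi> j) * c j) i - of_real (?\<psi> i) * mat_app A c i"
    unfolding z_def mat_app_cmult[symmetric]
    by (rule mat_app_diff[OF A(1) kfin kfin]) (rule cut)+
  then have "mat_app A (\<lambda>j. of_real (?\<psi> j) * c j) i = of_real (?\<psi> i) * mat_app A c i + z" by simp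
  then have "cmod (mat_app A (\<lambda>j. of_real (?\<psi> j) * c j) i) \<le> ?\<psi> i * cmod (mat_app A c i) + cmod z"
    using norm_triangle_ineq[of "of_real (?\<psi> i) * mat_app A c i" z] by (simp add: norm_mult cutoff_range)
  from ennreal_leI[OF this] have "cn (mat_app A (\<lambda>j. of_real (?\<psi> j) * c j)) i \<le> ennreal (?\<psi> i * cmod (mat_app A c i)) + ennreal (cmod z)"
    using cutoff_range[of N x i] by simp
  also have "\<dots> \<le> (if i \<in> nb x (2 * N) then cn (mat_app A c) i else 0) + ennreal (cmod z)"
    using cutoff_eq_0[OF N] cutoff_range[of N x i]
    by (intro add_right_mono) (auto intro!: ennreal_leI mult_left_le_one_le)
  also have "ennreal (cmod z) \<le> nsum (\<lambda>j. ennreal (cmod (A i j * (of_real (?\<psi> j) * c j - of_real (?\<psi> i) * c j))))"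
    unfolding z_def mat_app_def by (rule norm_infsum_le_nsum)
  also have "\<dots> \<le> nsum (\<lambda>j. nsum (\<lambda>R. ?b R * (if j \<in> nb i R then ?g j else 0)))"
  proof (rule nsum_mono)
    fix j
    have "cmod (of_real (?\<psi> j) * c j - of_real (?\<psi> i) * c j) = \<bar>?\<psi> j - ?\<psi> i\<bar> * cmod (c j)"
      by (metis left_diff_distrib norm_mult norm_of_real of_real_diff)
    then have "ennreal (cmod (A i j * (of_real (?\<psi> j) * c j - of_real (?\<psi> i) * c j)))
      = ennreal (cmod (A i j)) * (ennreal \<bar>?\<psi> j - ?\<psi> i\<bar> * cn c j)"
      by (simp add: norm_mult[of "A i j"] ennreal_mult)
    also have "\<dots> \<le> kern a (i - j) * (ennreal \<bar>?\<psi> j - ?\<psi> i\<bar> * cn c j)"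
      by (intro mult_right_mono dominatedD A) simp
    also have "\<dots> = nsum (\<lambda>R. a R * of_bool (j \<in> nb i R) * (ennreal \<bar>?\<psi> j - ?\<psi> i\<bar> * cn c j))"
      unfolding kern_diff by (rule nsum_multc[symmetric])
    also have "\<dots> \<le> nsum (\<lambda>R. ?b R * (if j \<in> nb i R then ?g j else 0))"
    proof (rule nsum_mono)
      fix R
      show "a R * of_bool (j \<in> nb i R) * (ennreal \<bar>?\<psi> j - ?\<psi> i\<bar> * cn c j) \<le> ?b R * (if j \<in> nb i R then ?g j else 0)"
      proof (cases "j \<in> nb i R \<and> (i \<in> nb x (2 * N) \<or> j \<in> nb x (2 * N))")
        case True
        then have "ennreal \<bar>?\<psi> j - ?\<psi> i\<bar> \<le> ennreal (min 1 (real R / real N))"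
          by (intro ennreal_leI cutoff_diff_le N) auto
        then have "a R * (ennreal \<bar>?\<psi> j - ?\<psi> i\<bar> * cn c j) \<le> a R * (ennreal (min 1 (real R / real N)) * cn c j)"
          by (intro mult_left_mono mult_right_mono) auto
        then show ?thesis using True by (auto simp: damp_def mult.assoc)
      qed (auto simp: cutoff_eq_0[OF N])
    qed
    finally show "ennreal (cmod (A i j * (of_real (?\<psi> j) * c j - of_real (?\<psi> i) * c j)))
      \<le> nsum (\<lambda>R. ?b R * (if j \<in> nb i R then ?g j else 0))" .
  qed
  also have "\<dots> = nsum (\<lambda>R. ?b R * sum ?g (nb i R))"
    by (subst nsum_swap) (simp add: nsum_cmult sum_eq_nsum)
  also have "\<dots> \<le> nsum (\<lambda>R. ?b R * (\<Sum>j\<in>nb i R. if j \<in> nb x (3 * N) then cn c j else 0)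
      + (if i \<in> nb x (2 * N) then (if N < R then ?b R else 0) * sum (cn c) (nb x (R + 2 * N)) else 0))"
  proof (rule nsum_mono)
    fix R
    show "?b R * sum ?g (nb i R) \<le> ?b R * (\<Sum>j\<in>nb i R. if j \<in> nb x (3 * N) then cn c j else 0)
      + (if i \<in> nb x (2 * N) then (if N < R then ?b R else 0) * sum (cn c) (nb x (R + 2 * N)) else 0)"
    proof (cases "i \<in> nb x (2 * N) \<and> N < R")
      case True
      have "sum ?g (nb i R) \<le> sum (cn c) (nb x (R + 2 * N))"
      proof -
        have "sum ?g (nb i R) = sum (cn c) (nb i R)" using True by (intro sum.cong) auto
        also have "\<dots> \<le> sum (cn c) (nb x (R + 2 * N))"
          using True by (intro sum_mono2) (auto intro: nb_trans[of i x "2 * N"])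
        finally show ?thesis .
      qed
      then have "?b R * sum ?g (nb i R) \<le> ?b R * sum (cn c) (nb x (R + 2 * N))"
        by (rule mult_left_mono) simp
      then show ?thesis using True by (simp add: add_increasing)
    next
      case False
      have "sum ?g (nb i R) \<le> (\<Sum>j\<in>nb i R. if j \<in> nb x (3 * N) then cn c j else 0)"
      proof (rule sum_mono)
        fix j assume j: "j \<in> nb i R"
        have "j \<in> nb x (3 * N)" if "i \<in> nb x (2 * N) \<or> j \<in> nb x (2 * N)"
          using that False nb_trans[OF _ j, of x "2 * N" "3 * N"] nb_mono[of "2 * N" "3 * N" x] by auto
        then show "?g j \<le> (if j \<in> nb x (3 * N) then cn c j else 0)" by auto
      qed
      then have "?b R * sum ?g (nb i R) \<le> ?b R * (\<Sum>j\<in>nb i R. if j \<in> nb x (3 * N) then cn c j else 0)"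
        by (rule mult_left_mono) simp
      then show ?thesis using False by auto
    qed
  qed
  also have "\<dots> = kop ?b (\<lambda>j. if j \<in> nb x (3 * N) then cn c j else 0) i
      + (if i \<in> nb x (2 * N) then nsum (\<lambda>R. (if N < R then ?b R else 0) * sum (cn c) (nb x (R + 2 * N))) else 0)"
    by (simp add: nsum_add kop_def)
  finally show ?thesis by (simp add: add_left_mono)
qed

section \<open>The pointwise bound\<close>

context aq_weight
begin

lemma Nrm_cn_cutoff_ge:
  assumes "1 \<le> N"
  shows "(\<Sum>i\<in>nb x N. w i * epw q (cn c i)) \<le> Nrm (cn (\<lambda>j. of_real (cutoff N x j) * c j))"
proof -
  have "(\<Sum>i\<in>nb x N. w i * epw q (cn c i)) = (\<Sum>i\<in>nb x N. w i * epw q (cn (\<lambda>j. of_real (cutoff N x j) * c j) i))"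
    by (intro sum.cong) (simp_all add: cutoff_eq_1[OF assms])
  also have "\<dots> \<le> Nrm (cn (\<lambda>j. of_real (cutoff N x j) * c j))"
    unfolding Nrm_def by (rule sum_le_nsum) simp
  finally show ?thesis .
qed

lemma sum_weighted_le:
  assumes "finite S" shows "(\<Sum>i\<in>S. w i * epw q (g i)) \<le> (\<Sum>i\<in>S. w i) * epw q (\<Sum>i\<in>S. g i)"
  unfolding sum_distrib_right
  by (intro sum_mono mult_left_mono epw_mono q_pos member_le_sum assms) auto

text \<open>Cells \<open>n \<in> nb m 4\<close> have centres within \<open>4 * N\<close> of
  \<open>ctr N m\<close> and radius \<open>N\<close>, so they lie in its ball of radius
  \<open>5 * N\<close>. The constant does not depend on \<open>N\<close>.\<close>

lemma doubling_5:
  assumes "nb y N \<subseteq> nb x (5 * N)"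
  shows "W x (5 * N) \<le> C0 * epw q (of_nat (5 ^ CARD('d))) * W y N"
proof -
  have "epw q (vol CARD('d) N) * W x (5 * N) \<le> C0 * epw q (vol CARD('d) (5 * N)) * W y N"
    by (rule doubling[OF assms])
  also have "\<dots> \<le> C0 * epw q (of_nat (5 ^ CARD('d)) * vol CARD('d) N) * W y N"
    by (intro mult_left_mono mult_right_mono epw_mono q_pos vol_le_scaled) auto
  also have "\<dots> = epw q (vol CARD('d) N) * (C0 * epw q (of_nat (5 ^ CARD('d))) * W y N)"
    by (simp only: epw_mult ac_simps)
  finally show ?thesis
    using vol_nonzero vol_less_top by (subst (asm) ennreal_mult_le_mult_iff) (auto simp: less_top)
qed

text \<open>Normalizing by the mass of the cell makes the weight disappear from the recursion below.\<close>

definition cell_avg :: "nat \<Rightarrow> (int ^ 'd \<Rightarrow> ennreal) \<Rightarrow> int ^ 'd \<Rightarrow> ennreal" where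
  "cell_avg N f m = epw (1 / q) ((\<Sum>i\<in>nb (ctr N m) N. w i * epw q (f i)) / W (ctr N m) N)"

lemma epw_root: "epw q (epw (1 / q) y) = y"
  using q by (intro epw_epw) simp

lemma cell_avg: "epw q (cell_avg N f m) * W (ctr N m) N = (\<Sum>i\<in>nb (ctr N m) N. w i * epw q (f i))"
  unfolding cell_avg_def epw_root
  using W_nonzero W_fin by (simp add: ennreal_divide_times ennreal_divide_self less_top[symmetric])

text \<open>The common mass cancels and the q-th root is taken; this turns weighted estimates on a
  ball into weight-free ones.\<close>

lemma le_of_epw_mult_W:
  assumes "epw q y * W x R \<le> B * epw q z * W x R" shows "y \<le> epw (1 / q) B * z"
proof -
  have "W x R * epw q y \<le> W x R * (B * epw q z)" using assms by (simp add: ac_simps)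
  then have "epw q y \<le> epw q (epw (1 / q) B * z)"
    unfolding epw_mult epw_root using W_nonzero W_fin by (subst (asm) ennreal_mult_le_mult_iff) (auto simp: less_top)
  then show ?thesis by (simp only: epw_le_iff[OF q_pos])
qed

text \<open>Supplies the a priori bound that \<open>neumann_profile\<close> asks for.\<close>

lemma cell_avg_le:
  assumes "\<And>i. f i \<le> F" shows "cell_avg N f m \<le> F"
proof -
  have "epw q (cell_avg N f m) * W (ctr N m) N \<le> (\<Sum>i\<in>nb (ctr N m) N. w i * epw q F)"
    unfolding cell_avg using assms by (intro sum_mono mult_left_mono epw_mono q_pos) auto
  also have "\<dots> = 1 * epw q F * W (ctr N m) N"
    by (simp only: sum_distrib_right[symmetric] mult_1_left mult.commute)
  finally show ?thesis using le_of_epw_mult_W[of "cell_avg N f m" _ _ 1 F] by (simp add: epw_def)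
qed

text \<open>The constant is free of \<open>w\<close> because the mass of the cell stands on both
  sides of \<open>testing\<close>. This serves the long ranges, where masses of different cells are
  not comparable.\<close>

lemma sum_cell_le:
  "(\<Sum>j\<in>nb (ctr N m) N. f j) \<le> epw (1 / q) C0 * (vol CARD('d) N * cell_avg N f m)"
proof (rule le_of_epw_mult_W)
  have "epw q (\<Sum>j\<in>nb (ctr N m) N. f j) * W (ctr N m) N
      \<le> C0 * epw q (vol CARD('d) N) * (\<Sum>j\<in>nb (ctr N m) N. w j * epw q (f j))"
    by (rule testing)
  also have "\<dots> = C0 * epw q (vol CARD('d) N * cell_avg N f m) * W (ctr N m) N"
    by (simp only: cell_avg[symmetric] epw_mult ac_simps)
  finally show "epw q (\<Sum>j\<in>nb (ctr N m) N. f j) * W (ctr N m) N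
      \<le> C0 * epw q (vol CARD('d) N * cell_avg N f m) * W (ctr N m) N" .
qed

text \<open>Doubling down to a one-point ball compares \<open>w i\<close> with the mass of its cell.
  The loss of a power of the volume is harmless, since \<open>N\<close> is already fixed where this
  is used.\<close>

lemma le_cell_avg:
  assumes "1 \<le> N"
  shows "f i \<le> epw (1 / q) (C0 * epw q (vol CARD('d) N)) * cell_avg N f (gdiv N i)"
proof (rule le_of_epw_mult_W)
  let ?x = "ctr N (gdiv N i)"
  have i: "i \<in> nb ?x N" by (rule mem_nb_ctr_gdiv[OF assms])
  have "epw q (f i) * W ?x N \<le> epw q (f i) * (C0 * epw q (vol CARD('d) N) * w i)"
    using doubling[of i 0 ?x N] i by (intro mult_left_mono) auto
  also have "\<dots> = C0 * epw q (vol CARD('d) N) * (w i * epw q (f i))" by (simp only: ac_simps)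
  also have "\<dots> \<le> C0 * epw q (vol CARD('d) N) * (\<Sum>i\<in>nb ?x N. w i * epw q (f i))"
    using i by (intro mult_left_mono member_le_sum) auto
  also have "\<dots> = C0 * epw q (vol CARD('d) N) * epw q (cell_avg N f (gdiv N i)) * W ?x N"
    by (simp only: cell_avg[symmetric] ac_simps)
  finally show "epw q (f i) * W ?x N \<le> C0 * epw q (vol CARD('d) N) * epw q (cell_avg N f (gdiv N i)) * W ?x N" .
qed

text \<open>Stability is applied to \<open>c\<close> cut off around one cell; the three terms are
  the source, the short ranges and the long ranges of \<open>commutator_le\<close>. It is essential
  that \<open>L\<close> is obtained before \<open>N\<close>, whose choice will depend on it.\<close>

lemma cell_avg_recursion:
  fixes A :: "'d inf_matrix"
  assumes A: "dominated a A" "pnorm CARD('d) a < top" and K: "K < top"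
    and stable: "\<And>c. finite {i. c i \<noteq> 0} \<Longrightarrow> Nrm (cn c) \<le> K * Nrm (cn (mat_app A c))"
  obtains L where "L < top"
    "\<And>N c F m. \<lbrakk>1 \<le> N; F < top; \<And>i. cn c i \<le> F\<rbrakk> \<Longrightarrow> cell_avg N (cn c) m
      \<le> L * (\<Sum>j\<in>nb (ctr N m) (2 * N). cn (mat_app A c) j)
       + (L * (pnorm CARD('d) (damp a N) * (\<Sum>n\<in>nb m 4. cell_avg N (cn c) n))
       + nsum (\<lambda>R. (L * ((if N < R then damp a N R else 0) * vol CARD('d) N)) * (\<Sum>n\<in>nb m (R div N + 3). cell_avg N (cn c) n)))"
proof -
  let ?v = "vol CARD('d)"
  \<comment> \<open>\<open>D\<close> compares the masses of a cell and its neighbours,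
    \<open>P\<close> is the constant of \<open>Nrm_kop_le\<close> and \<open>E2\<close> that of the
    quasi-triangle inequality for \<open>Nrm\<close>. None of them involves
    \<open>N\<close>.\<close>
  define D where "D = C0 * epw q (of_nat (5 ^ CARD('d)))"
  define P where "P = avg_const CARD('d) q C0"
  define E2 where "E2 = epw q 2"
  define M where "M = K * (E2 * (D + E2 * (P * D + D * C0)))"
  define L where "L = epw (1 / q) M"
  have "D < top" "P < top" "E2 < top"
    using C0_fin avg_const_fin
    by (auto simp: D_def P_def E2_def ennreal_mult_less_top power_less_top_ennreal intro!: epw_less_top)
  then have "M < top" using K C0_fin by (simp add: M_def ennreal_mult_less_top)
  then have L: "L < top" unfolding L_def by (rule epw_less_top)
  show ?thesis
  proof
    fix N :: nat and c :: "int ^ 'd \<Rightarrow> complex" and F and m :: "int ^ 'd"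
    assume N: "1 \<le> N" and F: "F < top" "\<And>i. cn c i \<le> F"
    define x where "x = ctr N m"
    define u where "u = cell_avg N (cn c)"
    define g where "g = cn (mat_app A c)"
    define \<beta> where "\<beta> = pnorm CARD('d) (damp a N)"
    define b where "b R = (if N < R then damp a N R else 0)" for R
    define G where "G = (\<Sum>j\<in>nb x (2 * N). g j)"
    define S where "S = (\<Sum>n\<in>nb m 4. u n)"
    define Y where "Y = nsum (\<lambda>R. (b R * ?v N) * (\<Sum>n\<in>nb m (R div N + 3). u n))"
    define f1 where "f1 i = (if i \<in> nb x (2 * N) then g i else 0)" for i
    define f2 where "f2 = kop (damp a N) (\<lambda>j. if j \<in> nb x (3 * N) then cn c j else 0)"
    define Y0 where "Y0 = nsum (\<lambda>R. b R * sum (cn c) (nb x (R + 2 * N)))"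
    define f3 where "f3 i = (if i \<in> nb x (2 * N) then Y0 else 0)" for i
    have W2: "W x (2 * N) \<le> D * W x N"
    proof -
      have "W x (2 * N) \<le> W x (5 * N)" by (intro W_mono nb_mono) simp
      also have "\<dots> \<le> D * W x N" unfolding D_def by (intro doubling_5 nb_mono) simp
      finally show ?thesis .
    qed
    have Wn: "W (ctr N n) N \<le> D * W x N" if "n \<in> nb m 4" for n
    proof -
      have "nb (ctr N n) N \<subseteq> nb x (5 * N)"
        using nb_trans[OF ctr_mem_nb[OF that, of N], of _ N "5 * N"] by (auto simp: x_def)
      then have "W (ctr N n) N \<le> W x (5 * N)" by (rule W_mono)
      also have "\<dots> \<le> D * W x N" unfolding D_def by (intro doubling_5 nb_mono) simp
      finally show ?thesis .
    qed
    have n1: "Nrm f1 \<le> D * epw q G * W x N"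
    proof -
      have "Nrm f1 \<le> W x (2 * N) * epw q G"
        unfolding f1_def Nrm_restrict[OF finite_nb] G_def by (rule sum_weighted_le) simp
      also have "\<dots> \<le> D * W x N * epw q G" by (intro mult_right_mono W2) simp
      finally show ?thesis by (simp only: ac_simps)
    qed
    have cells: "(\<Sum>i\<in>nb x (3 * N). w i * epw q (cn c i)) \<le> D * W x N * epw q S"
    proof -
      have "(\<Sum>i\<in>nb x (3 * N). w i * epw q (cn c i))
        \<le> (\<Sum>n\<in>nb m (3 * N div N + 1). \<Sum>i\<in>nb (ctr N n) N. w i * epw q (cn c i))"
        unfolding x_def by (rule sum_nb_ctr_le[OF N])
      also have "3 * N div N + 1 = 4" using N by simp
      also have "(\<Sum>n\<in>nb m 4. \<Sum>i\<in>nb (ctr N n) N. w i * epw q (cn c i)) = (\<Sum>n\<in>nb m 4. epw q (u n) * W (ctr N n) N)"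
        by (simp only: cell_avg u_def)
      also have "\<dots> \<le> (\<Sum>n\<in>nb m 4. epw q (u n) * (D * W x N))"
        by (intro sum_mono mult_left_mono Wn) auto
      also have "\<dots> = (\<Sum>n\<in>nb m 4. epw q (u n)) * (D * W x N)" by (simp only: sum_distrib_right)
      also have "\<dots> \<le> epw q S * (D * W x N)"
        unfolding S_def by (intro mult_right_mono sum_epw_le q) simp
      finally show ?thesis by (simp only: ac_simps)
    qed
    have n2: "Nrm f2 \<le> P * D * epw q (\<beta> * S) * W x N"
    proof -
      have "\<beta> < top"
        unfolding \<beta>_def using pnorm_damp_le A(2) by (rule le_less_trans)
      then have "Nrm f2 \<le> P * epw q \<beta> * Nrm (\<lambda>j. if j \<in> nb x (3 * N) then cn c j else 0)"
        unfolding f2_def P_def \<beta>_def by (rule Nrm_kop_le)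
      also have "\<dots> = P * epw q \<beta> * (\<Sum>i\<in>nb x (3 * N). w i * epw q (cn c i))"
        by (simp only: Nrm_restrict[OF finite_nb])
      also have "\<dots> \<le> P * epw q \<beta> * (D * W x N * epw q S)"
        by (intro mult_left_mono cells) simp
      finally show ?thesis by (simp only: epw_mult ac_simps)
    qed
    have Y0: "Y0 \<le> epw (1 / q) C0 * Y"
    proof -
      have "Y0 \<le> nsum (\<lambda>R. epw (1 / q) C0 * ((b R * ?v N) * (\<Sum>n\<in>nb m (R div N + 3). u n)))"
        unfolding Y0_def
      proof (rule nsum_mono)
        fix R
        have "sum (cn c) (nb x (R + 2 * N)) \<le> (\<Sum>n\<in>nb m ((R + 2 * N) div N + 1). sum (cn c) (nb (ctr N n) N))"
          unfolding x_def by (rule sum_nb_ctr_le[OF N])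
        also have "(R + 2 * N) div N + 1 = R div N + 3" using N by simp
        also have "(\<Sum>n\<in>nb m (R div N + 3). sum (cn c) (nb (ctr N n) N))
            \<le> (\<Sum>n\<in>nb m (R div N + 3). epw (1 / q) C0 * (?v N * u n))"
          unfolding u_def by (intro sum_mono sum_cell_le)
        also have "\<dots> = epw (1 / q) C0 * (?v N * (\<Sum>n\<in>nb m (R div N + 3). u n))"
          by (simp only: sum_distrib_left)
        finally have "b R * sum (cn c) (nb x (R + 2 * N)) \<le> b R * (epw (1 / q) C0 * (?v N * (\<Sum>n\<in>nb m (R div N + 3). u n)))"
          by (rule mult_left_mono) simp
        then show "b R * sum (cn c) (nb x (R + 2 * N)) \<le> epw (1 / q) C0 * ((b R * ?v N) * (\<Sum>n\<in>nb m (R div N + 3). u n))"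
          by (simp only: ac_simps)
      qed
      then show ?thesis by (simp only: nsum_cmult Y_def)
    qed
    \<comment> \<open>A constant on the ball: only the mass of this ball enters, no distant
      weight.\<close>
    have n3: "Nrm f3 \<le> D * C0 * epw q Y * W x N"
    proof -
      have "Nrm f3 = W x (2 * N) * epw q Y0"
        unfolding f3_def Nrm_restrict[OF finite_nb] by (simp only: sum_distrib_right)
      also have "\<dots> \<le> D * W x N * epw q (epw (1 / q) C0 * Y)"
        by (intro mult_mono W2 epw_mono q_pos Y0) auto
      finally show ?thesis by (simp only: epw_mult epw_root ac_simps)
    qed
    \<comment> \<open>Finite support of the cutoff is what allows \<open>stable\<close> to be
      applied.\<close>
    have fin: "finite {i. of_real (cutoff N x i) * c i \<noteq> 0}"
      by (rule finite_subset[of _ "nb x (2 * N)"]) (use cutoff_eq_0[OF N] in auto)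
    have "epw q (u m) * W x N = (\<Sum>i\<in>nb x N. w i * epw q (cn c i))"
      unfolding u_def x_def by (rule cell_avg)
    also have "\<dots> \<le> Nrm (cn (\<lambda>j. of_real (cutoff N x j) * c j))"
      by (rule Nrm_cn_cutoff_ge[OF N])
    also have "\<dots> \<le> K * Nrm (cn (mat_app A (\<lambda>j. of_real (cutoff N x j) * c j)))"
      by (rule stable[OF fin])
    also have "\<dots> \<le> K * Nrm (\<lambda>i. f1 i + (f2 i + f3 i))"
      unfolding f1_def f2_def f3_def Y0_def b_def g_def
      by (intro mult_left_mono Nrm_mono commutator_le[OF A N F(2,1)]) simp
    also have "\<dots> \<le> K * (E2 * (Nrm f1 + E2 * (Nrm f2 + Nrm f3)))"
      unfolding E2_def by (intro mult_left_mono order_trans[OF Nrm_add_le] add_left_mono Nrm_add_le) auto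
    \<comment> \<open>All three arguments are enlarged to their sum, so that a single q-th root
      suffices.\<close>
    also have "\<dots> \<le> K * (E2 * (D * epw q (G + (\<beta> * S + Y)) * W x N + E2 * (P * D * epw q (G + (\<beta> * S + Y)) * W x N + D * C0 * epw q (G + (\<beta> * S + Y)) * W x N)))"
      by (intro mult_left_mono add_mono order_trans[OF n1] order_trans[OF n2] order_trans[OF n3] mult_right_mono epw_mono q_pos)
        (auto simp: add_increasing add_increasing2)
    also have "\<dots> = M * epw q (G + (\<beta> * S + Y)) * W x N"
      by (simp only: M_def distrib_left distrib_right ac_simps)
    finally have "u m \<le> L * (G + (\<beta> * S + Y))"
      unfolding L_def by (rule le_of_epw_mult_W)
    also have "\<dots> = L * G + (L * (\<beta> * S) + nsum (\<lambda>R. (L * (b R * ?v N)) * (\<Sum>n\<in>nb m (R div N + 3). u n)))"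
      by (simp only: Y_def nsum_cmult[symmetric] distrib_left mult.assoc)
    finally show "cell_avg N (cn c) m
      \<le> L * (\<Sum>j\<in>nb (ctr N m) (2 * N). cn (mat_app A c) j)
       + (L * (pnorm CARD('d) (damp a N) * (\<Sum>n\<in>nb m 4. cell_avg N (cn c) n))
       + nsum (\<lambda>R. (L * ((if N < R then damp a N R else 0) * ?v N)) * (\<Sum>n\<in>nb m (R div N + 3). cell_avg N (cn c) n)))"
      unfolding u_def S_def G_def b_def \<beta>_def g_def x_def .
  qed (rule L)
qed

theorem pointwise_bound_if_stable:
  fixes A :: "'d inf_matrix"
  assumes A: "dominated a A" "pnorm CARD('d) a < top" and K: "K < top"
    and stable: "\<And>c. finite {i. c i \<noteq> 0} \<Longrightarrow> Nrm (cn c) \<le> K * Nrm (cn (mat_app A c))"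
  obtains \<omega> where "pnorm CARD('d) \<omega> < top"
    "\<forall>c F. F < top \<and> (\<forall>i. cn c i \<le> F) \<longrightarrow> (\<forall>i. cn c i \<le> kop \<omega> (cn (mat_app A c)) i)"
proof -
  let ?d = "CARD('d)"
  let ?v = "vol ?d"
  obtain L where L: "L < top" and rec: "\<And>N c F m. \<lbrakk>1 \<le> N; F < top; \<And>i. cn c i \<le> F\<rbrakk> \<Longrightarrow> cell_avg N (cn c) m
      \<le> L * (\<Sum>j\<in>nb (ctr N m) (2 * N). cn (mat_app A c) j)
       + (L * (pnorm ?d (damp a N) * (\<Sum>n\<in>nb m 4. cell_avg N (cn c) n))
       + nsum (\<lambda>R. (L * ((if N < R then damp a N R else 0) * ?v N)) * (\<Sum>n\<in>nb m (R div N + 3). cell_avg N (cn c) n)))"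
  proof (rule cell_avg_recursion[OF A K stable])
    fix L
    assume "L < top" and *: "\<And>N c F m. \<lbrakk>1 \<le> N; F < top; \<And>i. cn c i \<le> F\<rbrakk> \<Longrightarrow> cell_avg N (cn c) m
      \<le> L * (\<Sum>j\<in>nb (ctr N m) (2 * N). cn (mat_app A c) j)
       + (L * (pnorm ?d (damp a N) * (\<Sum>n\<in>nb m 4. cell_avg N (cn c) n))
       + nsum (\<lambda>R. (L * ((if N < R then damp a N R else 0) * ?v N)) * (\<Sum>n\<in>nb m (R div N + 3). cell_avg N (cn c) n)))"
    show thesis by (rule that[OF \<open>L < top\<close> *])
  qed
  \<comment> \<open>\<open>?v 4\<close> counts the cells met by short ranges, \<open>10 ^ ?d\<close>
    is the loss of long ranges on passing to the grid, and \<open>2 ^ ?d\<close> is the factor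
    demanded by \<open>neumann_profile\<close>.\<close>
  define T where "T = 2 ^ ?d * (L * (?v 4 + of_nat (10 ^ ?d)))"
  have T: "T < top" using L by (simp add: T_def ennreal_mult_less_top vol_less_top power_less_top_ennreal)
  have "0 < ennreal (1/2) / (T + 1)" using T by (simp add: ennreal_zero_less_divide del: ennreal_half)
  then obtain N where N: "1 \<le> N" "pnorm ?d (damp a N) \<le> ennreal (1/2) / (T + 1)"
    using pnorm_damp_small[OF A(2)] by blast
  define \<beta> where "\<beta> = pnorm ?d (damp a N)"
  have T\<beta>: "T * \<beta> \<le> ennreal (1/2)"
  proof -
    have "T * \<beta> \<le> (T + 1) * (ennreal (1/2) / (T + 1))"
      using N(2) unfolding \<beta>_def by (intro mult_mono) auto
    also have "\<dots> = ennreal (1/2) * (T + 1) / (T + 1)"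
      by (simp only: ennreal_times_divide mult.commute)
    also have "\<dots> = ennreal (1/2)"
      using T by (intro mult_divide_eq_ennreal) auto
    finally show ?thesis .
  qed
  define b where "b R = L * ((if N < R then damp a N R else 0) * ?v N)" for R
  \<comment> \<open>The grid kernel of the recursion: radius 4 for the short ranges, and each long
    range \<open>R\<close> moved to its grid radius \<open>R div N + 3\<close>.\<close>
  define v where "v n = L * \<beta> * (if n = 4 then 1 else 0) + rix b (\<lambda>R. R div N + 3) n" for n
  have v_apply: "nsum (\<lambda>n. v n * \<phi> n) = L * \<beta> * \<phi> 4 + nsum (\<lambda>R. b R * \<phi> (R div N + 3))" for \<phi>
  proof -
    have "nsum (\<lambda>n. v n * \<phi> n) = nsum (\<lambda>n. (if n = 4 then L * \<beta> * \<phi> n else 0) + rix b (\<lambda>R. R div N + 3) n * \<phi> n)"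
      unfolding v_def by (intro nn_integral_cong) (simp add: distrib_right)
    then show ?thesis by (simp only: nsum_add nsum_delta nsum_rix)
  qed
  have "2 ^ ?d * pnorm ?d v \<le> T * \<beta>"
  proof -
    have "pnorm ?d v = L * \<beta> * ?v 4 + nsum (\<lambda>R. b R * ?v (R div N + 3))"
      unfolding pnorm_def by (rule v_apply)
    also have "\<dots> \<le> L * \<beta> * ?v 4 + nsum (\<lambda>R. (L * of_nat (10 ^ ?d)) * (damp a N R * ?v R))"
    proof (intro add_left_mono nsum_mono)
      fix R
      show "b R * ?v (R div N + 3) \<le> (L * of_nat (10 ^ ?d)) * (damp a N R * ?v R)"
      proof (cases "N < R")
        case True
        \<comment> \<open>With \<open>y = N * (R div N)\<close> and \<open>z = R div N\<close> the
          left side is the product of the two side lengths, expanded. As \<open>N < R\<close>, the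
          size of a cell is absorbed by the range, and the loss is independent of
          \<open>N\<close>.\<close>
        have "4 * y + 14 * N + 2 * z + 7 \<le> 10 * (2 * R + 1)" if "y \<le> R" "z \<le> R" for y z
          using that True by simp
        from this[of "N * (R div N)" "R div N"]
        have "4 * (N * (R div N)) + 14 * N + 2 * (R div N) + 7 \<le> 10 * (2 * R + 1)" by simp
        moreover have "(2 * N + 1) * (2 * (R div N + 3) + 1) = 4 * (N * (R div N)) + 14 * N + 2 * (R div N) + 7"
          by (simp add: distrib_left distrib_right)
        ultimately have "(2 * N + 1) * (2 * (R div N + 3) + 1) \<le> 10 * (2 * R + 1)" by (simp only:)
        then have "?v N * ?v (R div N + 3) \<le> of_nat (10 ^ ?d) * ?v R" by (rule vol_mult_le_scaled)
        then have "(L * damp a N R) * (?v N * ?v (R div N + 3)) \<le> (L * damp a N R) * (of_nat (10 ^ ?d) * ?v R)"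
          by (rule mult_left_mono) simp
        then show ?thesis using True by (simp add: b_def ac_simps)
      qed (simp add: b_def)
    qed
    also have "\<dots> = L * (?v 4 + of_nat (10 ^ ?d)) * \<beta>"
      unfolding nsum_cmult \<beta>_def pnorm_def by (simp only: distrib_left distrib_right ac_simps)
    finally have "2 ^ ?d * pnorm ?d v \<le> 2 ^ ?d * (L * (?v 4 + of_nat (10 ^ ?d)) * \<beta>)"
      by (rule mult_left_mono) simp
    then show ?thesis by (simp only: T_def mult.assoc)
  qed
  then have small: "2 ^ ?d * pnorm ?d v \<le> ennreal (1/2)" using T\<beta> by (rule order_trans)
  obtain \<omega> where \<omega>: "pnorm ?d \<omega> < top"
    "\<forall>(u :: int ^ 'd \<Rightarrow> ennreal) \<alpha> U. U < top \<and> (\<forall>m. u m \<le> U \<and> u m \<le> \<alpha> m + kop v u m) \<longrightarrow> (\<forall>m. u m \<le> kop \<omega> \<alpha> m)"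
    by (rule neumann_profile[OF small])
  define Z where "Z = epw (1 / q) (C0 * epw q (?v N))"
  have Z: "Z < top" unfolding Z_def using C0_fin
    by (intro epw_less_top) (simp add: ennreal_mult_less_top epw_less_top vol_less_top)
  \<comment> \<open>A grid radius \<open>R\<close> costs \<open>N\<close> from \<open>i\<close> to
    the centre of its cell, \<open>N * R\<close> along the grid and \<open>2 * N\<close> inside the
    last ball. The factor \<open>?v 3\<close> bounds how many balls of radius \<open>2 * N\<close>
    around grid points contain one \<open>j\<close>.\<close>
  define \<omega>' where "\<omega>' = rix (\<lambda>R. (Z * L * ?v 3) * \<omega> R) (\<lambda>R. N * (R + 3))"
  show ?thesis
  proof
    have "pnorm ?d \<omega>' = nsum (\<lambda>R. (Z * L * ?v 3) * \<omega> R * ?v (N * (R + 3)))"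
      unfolding pnorm_def \<omega>'_def by (rule nsum_rix)
    also have "\<dots> \<le> nsum (\<lambda>R. (Z * L * ?v 3) * \<omega> R * (of_nat ((7 * N) ^ ?d) * ?v R))"
    proof (intro nsum_mono mult_left_mono vol_le_scaled)
      show "2 * (N * (R + 3)) + 1 \<le> 7 * N * (2 * R + 1)" for R
        using N(1) by (simp add: algebra_simps)
    qed simp
    also have "\<dots> = nsum (\<lambda>R. (Z * L * ?v 3 * of_nat ((7 * N) ^ ?d)) * (\<omega> R * ?v R))"
      by (simp only: ac_simps)
    also have "\<dots> = Z * L * ?v 3 * of_nat ((7 * N) ^ ?d) * pnorm ?d \<omega>"
      by (simp only: nsum_cmult pnorm_def)
    also have "\<dots> < top"
      using Z L \<omega>(1) by (intro ennreal_mult_less_top[THEN iffD2] conjI disjI2 vol_less_top of_nat_less_top)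
    finally show "pnorm ?d \<omega>' < top" .
    show "\<forall>c F. F < top \<and> (\<forall>i. cn c i \<le> F) \<longrightarrow> (\<forall>i. cn c i \<le> kop \<omega>' (cn (mat_app A c)) i)"
    proof (intro allI impI, elim conjE)
      fix c :: "int ^ 'd \<Rightarrow> complex" and F and i :: "int ^ 'd" assume F': "F < top" "\<forall>i. cn c i \<le> F"
      then have F: "F < top" "\<And>i. cn c i \<le> F" by auto
      let ?g = "cn (mat_app A c)" and ?m = "gdiv N i"
      have "cell_avg N (cn c) ?m \<le> kop \<omega> (\<lambda>m. L * (\<Sum>j\<in>nb (ctr N m) (2 * N). ?g j)) ?m"
      proof (rule \<omega>(2)[rule_format], intro conjI allI)
        show "F < top" by (rule F)
        show "cell_avg N (cn c) m \<le> F" for m by (rule cell_avg_le) (rule F)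
        show "cell_avg N (cn c) m \<le> L * (\<Sum>j\<in>nb (ctr N m) (2 * N). ?g j) + kop v (cell_avg N (cn c)) m" for m
          using rec[where N=N and c=c and F=F and m=m, OF N(1) F] unfolding kop_def v_apply b_def \<beta>_def by (simp only: mult.assoc)
      qed
      also have "\<dots> = L * nsum (\<lambda>R. \<omega> R * (\<Sum>n\<in>nb ?m R. \<Sum>j\<in>nb (ctr N n) (2 * N). ?g j))"
        unfolding kop_cmult by (simp only: kop_def)
      also have "\<dots> \<le> L * nsum (\<lambda>R. \<omega> R * (?v 3 * (\<Sum>j\<in>nb i (N * (R + 3)). ?g j)))"
      proof (intro mult_left_mono nsum_mono)
        fix R
        have "(\<Sum>n\<in>nb ?m R. \<Sum>j\<in>nb (ctr N n) (2 * N). ?g j)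
          \<le> (\<Sum>n\<in>nb ?m R. \<Sum>j\<in>nb i (N * (R + 3)). if n \<in> nb (gdiv N j) 3 then ?g j else 0)"
        proof (rule sum_mono)
          fix n assume n: "n \<in> nb ?m R"
          have "ctr N ?m \<in> nb i N"
            using mem_nb_ctr_gdiv[OF N(1), of i] by (simp only: mem_nb_commute[of i])
          then have near_i: "ctr N n \<in> nb i (N + N * R)"
            by (rule nb_trans[OF _ ctr_mem_nb[OF n]]) simp
          have sub: "nb (ctr N n) (2 * N) \<subseteq> nb i (N * (R + 3))"
          proof
            fix j assume "j \<in> nb (ctr N n) (2 * N)"
            then show "j \<in> nb i (N * (R + 3))"
              by (rule nb_trans[OF near_i]) (simp add: distrib_left)
          qed
          have near: "n \<in> nb (gdiv N j) 3" if "j \<in> nb (ctr N n) (2 * N)" for j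
          proof -
            have "2 * N div N + 1 = 3" using N(1) by simp
            then have "gdiv N j \<in> nb n 3" using gdiv_mem_nb[OF N(1) that] by (simp only:)
            then show ?thesis by (simp only: mem_nb_commute[of n])
          qed
          have "(\<Sum>j\<in>nb (ctr N n) (2 * N). ?g j) = (\<Sum>j\<in>nb (ctr N n) (2 * N). if n \<in> nb (gdiv N j) 3 then ?g j else 0)"
            using near by (intro sum.cong) auto
          also have "\<dots> \<le> (\<Sum>j\<in>nb i (N * (R + 3)). if n \<in> nb (gdiv N j) 3 then ?g j else 0)"
            by (intro sum_mono2 sub) auto
          finally show "(\<Sum>j\<in>nb (ctr N n) (2 * N). ?g j) \<le> (\<Sum>j\<in>nb i (N * (R + 3)). if n \<in> nb (gdiv N j) 3 then ?g j else 0)" .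
        qed
        also have "\<dots> = (\<Sum>j\<in>nb i (N * (R + 3)). \<Sum>n\<in>nb ?m R. if n \<in> nb (gdiv N j) 3 then ?g j else 0)"
          by (rule sum.swap)
        also have "\<dots> \<le> (\<Sum>j\<in>nb i (N * (R + 3)). ?v 3 * ?g j)"
        proof (rule sum_mono)
          fix j
          have "(\<Sum>n\<in>nb ?m R. if n \<in> nb (gdiv N j) 3 then ?g j else 0) = (\<Sum>n\<in>nb ?m R \<inter> nb (gdiv N j) 3. ?g j)"
            by (rule sum.inter_restrict[symmetric]) simp
          also have "\<dots> \<le> (\<Sum>n\<in>nb (gdiv N j) 3. ?g j)" by (intro sum_mono2) auto
          finally show "(\<Sum>n\<in>nb ?m R. if n \<in> nb (gdiv N j) 3 then ?g j else 0) \<le> ?v 3 * ?g j"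
            by (simp only: sum_const_nb)
        qed
        finally show "(\<Sum>n\<in>nb ?m R. \<Sum>j\<in>nb (ctr N n) (2 * N). ?g j) \<le> ?v 3 * (\<Sum>j\<in>nb i (N * (R + 3)). ?g j)"
          by (simp only: sum_distrib_left)
      qed auto
      finally have "Z * cell_avg N (cn c) ?m \<le> Z * (L * nsum (\<lambda>R. \<omega> R * (?v 3 * (\<Sum>j\<in>nb i (N * (R + 3)). ?g j))))"
        by (rule mult_left_mono) simp
      also have "\<dots> = nsum (\<lambda>R. (Z * L * ?v 3) * \<omega> R * (\<Sum>j\<in>nb i (N * (R + 3)). ?g j))"
        unfolding nsum_cmult[symmetric] by (simp only: ac_simps)
      also have "\<dots> = kop \<omega>' ?g i"
        unfolding kop_def \<omega>'_def by (rule nsum_rix[symmetric])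
      finally show "cn c i \<le> kop \<omega>' ?g i"
        using le_cell_avg[OF N(1), of "cn c" i] unfolding Z_def[symmetric] by (rule order_trans[rotated])
    qed
  qed
qed

end

section \<open>Inversion on unweighted \<open>\<ell>\<^sup>2\<close> and the left inverse\<close>

lemma epw_2_ennreal: "0 \<le> r \<Longrightarrow> epw 2 (ennreal r) = ennreal (r\<^sup>2)"
  by (simp add: epw_ennreal)

lemma (in aq_weight) Nrm_less_topD:
  assumes "Nrm f < top" shows "f i < top"
proof -
  have "w i * epw q (f i) \<le> Nrm f" unfolding Nrm_def by (rule le_nsum)
  then have "w i * epw q (f i) < top" using assms by (rule le_less_trans)
  then show ?thesis using w_pos[of i] by (auto simp: less_top[symmetric] ennreal_mult_eq_top_iff)
qed

lemma (in aq_weight) Nrm_kop_less_top: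
  assumes "pnorm CARD('d) a < top" "Nrm f < top" shows "Nrm (kop a f) < top"
proof -
  have "avg_const CARD('d) q C0 * epw q (pnorm CARD('d) a) * Nrm f < top"
    using assms avg_const_fin by (simp add: ennreal_mult_less_top epw_less_top)
  then show ?thesis by (rule le_less_trans[OF Nrm_kop_le[OF assms(1)]])
qed

text \<open>For \<open>q = 1\<close> the mass of a ball is at most a multiple of its volume times
  \<open>w j\<close> at each of its points; multiply by \<open>f j\<close> and sum. For
  \<open>q > 1\<close> it is Hoelder: Jensen for the dual weight \<open>s\<close> applied to
  \<open>f / s\<close>, followed by the A_q bound.\<close>

lemma aq_weight_if_discrete_A_weight:
  fixes w :: "int ^ 'd::finite \<Rightarrow> real"
  assumes q: "1 \<le> q" and A: "discrete_A_weight q w"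
  obtains C0 where "aq_weight q (\<lambda>i. ennreal (w i)) C0"
proof -
  have w: "0 < w i" for i using A by (simp add: discrete_A_weight_def)
  define p where "p R = real (2 * R + 1) ^ CARD('d)" for R :: nat
  have p: "0 < p R" "vol CARD('d) R = ennreal (p R)" for R
    by (simp_all add: p_def vol_def ennreal_of_nat_eq_real_of_nat)
  have cubes: "\<exists>a. nb x R = cube a (2 * R + 1)" for x :: "int ^ 'd" and R
    using nb_eq_cube by blast
  have Wp: "0 < sum w (nb x R)" for x R by (intro sum_pos) (auto simp: w intro: self_mem_nb)
  have "\<exists>C. \<forall>x R f. epw q (\<Sum>j\<in>nb x R. f j) * (\<Sum>j\<in>nb x R. ennreal (w j))
      \<le> ennreal C * epw q (vol CARD('d) R) * (\<Sum>j\<in>nb x R. ennreal (w j) * epw q (f j))"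
  proof (cases "q = 1")
    case True
    have epw1: "epw 1 y = y" for y by (cases y) (auto simp: epw_ennreal)
    obtain C where C: "\<And>a N. 1 \<le> N \<Longrightarrow> cube_avg a N w \<le> C * (INF i\<in>cube a N. w i)"
      using A True by (auto simp: discrete_A_weight_def)
    have key: "sum w (nb x R) \<le> C * p R * w j" if j: "j \<in> nb x R" for x R j
    proof -
      obtain a where a: "nb x R = cube a (2 * R + 1)" using cubes by blast
      have inf: "(INF i\<in>nb x R. w i) \<le> w j" by (intro cINF_lower j) auto
      have inf0: "0 \<le> (INF i\<in>nb x R. w i)"
        using j w by (intro cINF_greatest) (auto simp: less_imp_le)
      have *: "sum w (nb x R) / p R \<le> C * (INF i\<in>nb x R. w i)"
        using C[of "2 * R + 1" a] by (simp add: cube_avg_def a p_def)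
      have "0 < C * (INF i\<in>nb x R. w i)"
        using * Wp[of x R] p(1)[of R] by (meson divide_pos_pos less_le_trans)
      then have "0 \<le> C" using inf0 by (auto simp: zero_less_mult_iff)
      then have "sum w (nb x R) / p R \<le> C * w j" using * inf by (meson mult_left_mono order_trans)
      then show ?thesis using p(1)[of R] by (simp add: field_simps)
    qed
    show ?thesis
    proof (intro exI allI)
      fix x :: "int ^ 'd" and R and f :: "int ^ 'd \<Rightarrow> ennreal"
      have "(\<Sum>j\<in>nb x R. f j) * (\<Sum>j\<in>nb x R. ennreal (w j)) = (\<Sum>j\<in>nb x R. f j * ennreal (sum w (nb x R)))"
        by (simp add: sum_distrib_right sum_ennreal w less_imp_le)
      also have "\<dots> \<le> (\<Sum>j\<in>nb x R. f j * (ennreal C * ennreal (p R) * ennreal (w j)))"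
      proof (intro sum_mono mult_left_mono)
        fix j assume "j \<in> nb x R"
        then have "ennreal (sum w (nb x R)) \<le> ennreal (C * p R * w j)" by (intro ennreal_leI key)
        then show "ennreal (sum w (nb x R)) \<le> ennreal C * ennreal (p R) * ennreal (w j)"
          using w[of j] p(1)[of R] by (simp add: ennreal_mult'')
      qed simp
      also have "\<dots> = ennreal C * vol CARD('d) R * (\<Sum>j\<in>nb x R. ennreal (w j) * f j)"
        by (simp add: p sum_distrib_left ac_simps)
      finally show "epw q (\<Sum>j\<in>nb x R. f j) * (\<Sum>j\<in>nb x R. ennreal (w j))
        \<le> ennreal C * epw q (vol CARD('d) R) * (\<Sum>j\<in>nb x R. ennreal (w j) * epw q (f j))"
        by (simp add: True epw1)
    qed
  next
    case False
    then have q1: "1 < q" using q by simp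
    define s where "s i = w i powr (- 1 / (q - 1))" for i
    have s: "0 < s i" for i using w[of i] by (simp add: s_def)
    \<comment> \<open>The exponent of the dual weight is chosen so that
      \<open>s powr (1 - q)\<close> is \<open>w\<close>.\<close>
    have sw: "ennreal (s i) * epw q (inverse (ennreal (s i))) = ennreal (w i)" for i
    proof -
      have "s i * inverse (s i) powr q = s i powr (1 - q)"
        using s[of i] by (simp add: inverse_eq_divide powr_divide powr_diff)
      also have "\<dots> = w i powr 1"
      proof -
        have "- 1 / (q - 1) * (1 - q) = 1" using q1 by (simp add: divide_simps)
        then show ?thesis by (simp only: s_def powr_powr)
      qed
      also have "\<dots> = w i" using w[of i] by simp
      finally show ?thesis
        using s[of i] by (simp add: inverse_ennreal epw_ennreal ennreal_mult[symmetric])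
    qed
    obtain C where C: "\<And>a N. 1 \<le> N \<Longrightarrow> cube_avg a N w * (cube_avg a N s) powr (q - 1) \<le> C"
      using A q1 unfolding discrete_A_weight_def s_def by auto
    show ?thesis
    proof (intro exI allI)
      fix x :: "int ^ 'd" and R and f :: "int ^ 'd \<Rightarrow> ennreal"
      let ?Q = "nb x R"
      define S where "S = sum s ?Q"
      define V where "V = sum w ?Q"
      have S: "0 < S" unfolding S_def by (intro sum_pos) (auto simp: s intro: self_mem_nb)
      have V: "0 < V" unfolding V_def by (rule Wp)
      have V': "(\<Sum>j\<in>?Q. ennreal (w j)) = ennreal V" by (simp add: V_def w less_imp_le)
      \<comment> \<open>The A_q inequality cleared of denominators and multiplied by
        \<open>S\<close>, to match the factors in \<open>nsum_jensen\<close>.\<close>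
      have AQ: "S powr q * V \<le> S * (C * p R powr q)"
      proof -
        obtain a where a: "?Q = cube a (2 * R + 1)" using cubes by blast
        have "V / p R * (S / p R) powr (q - 1) \<le> C"
          using C[of "2 * R + 1" a] by (simp add: cube_avg_def a p_def S_def V_def)
        then have "V * S powr (q - 1) / (p R * p R powr (q - 1)) \<le> C"
          using S p(1)[of R] by (simp add: powr_divide)
        also have "p R * p R powr (q - 1) = p R powr q"
          using powr_mult_base[of "p R" "q - 1"] p(1)[of R] by simp
        finally have "V * S powr (q - 1) \<le> C * p R powr q"
          using p(1)[of R] by (simp add: field_simps)
        then have "S * (V * S powr (q - 1)) \<le> S * (C * p R powr q)"
          using S by (intro mult_left_mono) auto
        also have "S * (V * S powr (q - 1)) = S powr q * V"
          using powr_mult_base[of S "q - 1"] S by (simp add: ac_simps)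
        finally show ?thesis .
      qed
      define a where "a j = (if j \<in> ?Q then ennreal (s j) else 0)" for j
      define y where "y j = inverse (ennreal (s j)) * f j" for j
      have "nsum a = (\<Sum>j\<in>?Q. ennreal (s j))" by (simp add: a_def sum_eq_nsum)
      then have nsa: "nsum a = ennreal S" by (simp add: S_def s less_imp_le)
      have inv: "ennreal (s j) * inverse (ennreal (s j)) = 1" for j
        using s[of j] by (simp add: inverse_ennreal ennreal_mult[symmetric])
      have "nsum (\<lambda>j. a j * y j) = nsum (\<lambda>j. if j \<in> ?Q then f j else 0)"
        by (intro nn_integral_cong) (simp add: a_def y_def mult.assoc[symmetric] inv)
      then have nsay: "nsum (\<lambda>j. a j * y j) = sum f ?Q" by (simp add: sum_eq_nsum)
      have "nsum (\<lambda>j. a j * epw q (y j)) = nsum (\<lambda>j. if j \<in> ?Q then ennreal (w j) * epw q (f j) else 0)"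
        by (intro nn_integral_cong) (simp add: a_def y_def epw_mult mult.assoc[symmetric] sw)
      then have nsae: "nsum (\<lambda>j. a j * epw q (y j)) = (\<Sum>j\<in>?Q. ennreal (w j) * epw q (f j))"
        by (simp add: sum_eq_nsum)
      let ?I = "\<Sum>j\<in>?Q. ennreal (w j) * epw q (f j)"
      have "ennreal S * epw q (sum f ?Q) \<le> epw q (ennreal S) * ?I"
        using nsum_jensen[OF q, of a y] unfolding nsa nsay nsae by simp
      then have "(ennreal S * epw q (sum f ?Q)) * ennreal V \<le> (epw q (ennreal S) * ?I) * ennreal V"
        by (rule mult_right_mono) simp
      also have "\<dots> = ennreal (S powr q * V) * ?I"
        using S V by (simp add: epw_ennreal ennreal_mult ac_simps)
      also have "\<dots> \<le> ennreal (S * (C * p R powr q)) * ?I"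
        by (intro mult_right_mono ennreal_leI AQ) simp
      also have "\<dots> = ennreal S * (ennreal C * epw q (vol CARD('d) R) * ?I)"
        using S p(1)[of R] by (simp add: p(2) epw_ennreal ennreal_mult' ennreal_mult'' ac_simps)
      finally have "ennreal S * (epw q (sum f ?Q) * ennreal V) \<le> ennreal S * (ennreal C * epw q (vol CARD('d) R) * ?I)"
        by (simp only: mult.assoc)
      then show "epw q (sum f ?Q) * (\<Sum>j\<in>?Q. ennreal (w j)) \<le> ennreal C * epw q (vol CARD('d) R) * ?I"
        unfolding V' using S by (subst (asm) ennreal_mult_le_mult_iff) auto
    qed
  qed
  then obtain C where C: "\<And>x R f. epw q (\<Sum>j\<in>nb x R. f j) * (\<Sum>j\<in>nb x R. ennreal (w j))
      \<le> ennreal C * epw q (vol CARD('d) R) * (\<Sum>j\<in>nb x R. ennreal (w j) * epw q (f j))"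
    by blast
  show ?thesis
    by (rule that[of "ennreal C"], unfold_locales) (auto simp: q w C)
qed

text \<open>Makes unweighted l^2 an instance of the weighted theory, so that the pointwise bound is
  available there too.\<close>

lemma discrete_A_weight_1: "discrete_A_weight 2 (\<lambda>_ :: int ^ 'd::finite. 1)"
proof -
  have "cube_avg a N (\<lambda>_. 1) = 1" if "1 \<le> N" for a :: "int ^ 'd" and N
    using that by (simp add: cube_avg_def card_cube)
  then show ?thesis
    unfolding discrete_A_weight_def by (intro conjI disjI2 exI[of _ 1]) auto
qed

lemma ennreal_mult_le_sum_epw_2: "x * y \<le> epw 2 x + epw 2 y"
proof -
  have "x * y \<le> max x y * max x y" by (intro mult_mono) auto
  also have "\<dots> = epw 2 (max x y)"
    by (cases "max x y") (auto simp: epw_2_ennreal power2_eq_square ennreal_mult)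
  also have "\<dots> \<le> epw 2 x + epw 2 y" by (auto simp: max_def)
  finally show ?thesis .
qed

locale l2_weight = aq_weight 2 w C0 for w :: "int ^ 'd::finite \<Rightarrow> ennreal" and C0 +
  assumes w_eq_1: "w i = 1"
begin

lemma Nrm_eq: "Nrm f = nsum (\<lambda>i. epw 2 (f i))"
  by (simp add: Nrm_def w_eq_1)

abbreviation (input) sq :: "(int ^ 'd \<Rightarrow> complex) \<Rightarrow> int ^ 'd \<Rightarrow> real" where
  "sq v \<equiv> \<lambda>i. (cmod (v i))\<^sup>2"

lemma Nrm_cn: "Nrm (cn v) = nsum (\<lambda>i. ennreal (sq v i))"
  by (simp add: Nrm_eq epw_2_ennreal)

lemma summable_sq: "Nrm (cn v) < top \<longleftrightarrow> sq v summable_on UNIV"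
  unfolding Nrm_cn by (subst summable_on_iff_nsum) auto

lemma Nrm_cn_eq_infsum: "Nrm (cn v) < top \<Longrightarrow> Nrm (cn v) = ennreal (infsum (sq v) UNIV)"
  unfolding summable_sq unfolding Nrm_cn by (rule nsum_eq_infsum) auto

lemma cn_bounded: "cn v i \<le> epw (1/2) (Nrm (cn v))"
proof -
  have "epw 2 (cn v i) \<le> Nrm (cn v)"
    unfolding Nrm_eq using le_nsum[of "\<lambda>i. epw 2 (cn v i)" i] by simp
  then have "epw 2 (cn v i) \<le> epw 2 (epw (1/2) (Nrm (cn v)))" by (simp add: epw_epw)
  then show ?thesis by (subst (asm) epw_le_iff) auto
qed

lemma Nrm_mat_app_less_top:
  assumes "dominated t T" "pnorm CARD('d) t < top" "Nrm (cn v) < top"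
  shows "Nrm (cn (mat_app T v)) < top"
  by (rule le_less_trans[OF Nrm_mono Nrm_kop_less_top]) (rule mat_app_le_kop assms)+

lemma summable_cross:
  assumes "Nrm (cn v) < top" "Nrm (cn z) < top"
  shows "(\<lambda>i. norm (cnj (v i) * z i)) summable_on UNIV"
proof (rule abs_summable_if_nsum)
  have "nsum (\<lambda>i. ennreal (norm (cnj (v i) * z i))) \<le> nsum (\<lambda>i. epw 2 (cn v i) + epw 2 (cn z i))"
    by (intro nsum_mono) (simp add: norm_mult ennreal_mult ennreal_mult_le_sum_epw_2)
  also have "\<dots> = Nrm (cn v) + Nrm (cn z)" by (simp add: nsum_add Nrm_eq)
  finally show "nsum (\<lambda>i. ennreal (norm (cnj (v i) * z i))) < top"
    using assms by (meson ennreal_add_less_top le_less_trans)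
qed

lemma summable_Re_cross:
  assumes "Nrm (cn v) < top" "Nrm (cn z) < top"
  shows "(\<lambda>i. Re (cnj (v i) * z i)) summable_on UNIV"
  by (rule summable_on_Re[OF abs_summable_summable[OF summable_cross[OF assms]]])

text \<open>The inner product is bounded by the arithmetic-geometric mean inequality with weights
  tuned to \<open>\<delta>\<close>, so that half of the left side absorbs one term. The result is
  the stability hypothesis of the pointwise bound, now for \<open>T\<close>.\<close>

lemma coercive_lower_bound:
  assumes T: "dominated t T" "pnorm CARD('d) t < top" and \<delta>: "0 < \<delta>"
    and coercive: "\<And>v. Nrm (cn v) < top \<Longrightarrow> \<delta> * infsum (sq v) UNIV \<le> (\<Sum>\<^sub>\<infinity>i. Re (cnj (v i) * mat_app T v i))"
    and v: "Nrm (cn v) < top"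
  shows "Nrm (cn v) \<le> ennreal (1 / \<delta>\<^sup>2) * Nrm (cn (mat_app T v))"
proof -
  let ?z = "mat_app T v"
  have z: "Nrm (cn ?z) < top" by (rule Nrm_mat_app_less_top[OF T v])
  have sv: "sq v summable_on UNIV" and sz: "sq ?z summable_on UNIV" using v z by (simp_all add: summable_sq)
  have "\<delta> * infsum (sq v) UNIV \<le> (\<Sum>\<^sub>\<infinity>i. Re (cnj (v i) * ?z i))" by (rule coercive[OF v])
  also have "\<dots> \<le> (\<Sum>\<^sub>\<infinity>i. \<delta> / 2 * sq v i + 1 / (2 * \<delta>) * sq ?z i)"
  proof (rule infsum_mono)
    fix i
    have "Re (cnj (v i) * ?z i) \<le> cmod (v i) * cmod (?z i)"
      using complex_Re_le_cmod[of "cnj (v i) * ?z i"] by (simp add: norm_mult)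
    also have "\<dots> \<le> \<delta> / 2 * sq v i + 1 / (2 * \<delta>) * sq ?z i"
    proof -
      have "0 \<le> (\<delta> * cmod (v i) - cmod (?z i))\<^sup>2" by simp
      then show ?thesis using \<delta> by (simp add: power2_eq_square field_simps)
    qed
    finally show "Re (cnj (v i) * ?z i) \<le> \<delta> / 2 * sq v i + 1 / (2 * \<delta>) * sq ?z i" .
  qed (intro summable_Re_cross v z summable_on_add summable_on_cmult_right sv sz)+
  also have "\<dots> = \<delta> / 2 * infsum (sq v) UNIV + 1 / (2 * \<delta>) * infsum (sq ?z) UNIV"
    unfolding infsum_add[OF summable_on_cmult_right[OF sv] summable_on_cmult_right[OF sz]]
    by (simp only: infsum_cmult_right')
  finally have "infsum (sq v) UNIV \<le> 1 / \<delta>\<^sup>2 * infsum (sq ?z) UNIV"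
    using \<delta> by (simp add: field_simps power2_eq_square)
  then show ?thesis
    unfolding Nrm_cn_eq_infsum[OF v] Nrm_cn_eq_infsum[OF z]
    by (simp add: ennreal_mult'[symmetric] ennreal_leI)
qed

text \<open>Richardson iteration \<open>v - \<tau> T v\<close>: for small \<open>\<tau>\<close> it contracts, since
  \<open>\<parallel>v - \<tau> T v\<parallel>\<^sup>2 = \<parallel>v\<parallel>\<^sup>2 - 2 \<tau> Re \<langle>v, T v\<rangle> + \<tau>\<^sup>2 \<parallel>T v\<parallel>\<^sup>2\<close>.\<close>

lemma coercive_contraction:
  assumes T: "dominated t T" "pnorm CARD('d) t < top" and \<delta>: "0 < \<delta>"
    and coercive: "\<And>v. Nrm (cn v) < top \<Longrightarrow> \<delta> * infsum (sq v) UNIV \<le> (\<Sum>\<^sub>\<infinity>i. Re (cnj (v i) * mat_app T v i))"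
  obtains \<tau> r :: real where "0 < \<tau>" "0 \<le> r" "r < 1"
    "\<forall>v. Nrm (cn v) < top \<longrightarrow> Nrm (cn (\<lambda>i. v i - of_real \<tau> * mat_app T v i)) \<le> ennreal r * Nrm (cn v)"
proof -
  define B where "B = avg_const CARD('d) 2 C0 * epw 2 (pnorm CARD('d) t)"
  have "B < top" using T(2) avg_const_fin by (simp add: B_def ennreal_mult_less_top epw_less_top)
  then obtain b where b: "B = ennreal b" "0 \<le> b" by (cases B) auto
  \<comment> \<open>\<open>M\<close> bounds the squared norm of \<open>T\<close> and is at least
    \<open>\<delta>\<^sup>2\<close>. Then \<open>\<tau> = \<delta> / M\<close> minimizes
    \<open>1 - 2 * \<tau> * \<delta> + \<tau>\<^sup>2 * M\<close>, and the minimum \<open>r\<close>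
    is nonnegative.\<close>
  define M where "M = b + \<delta>\<^sup>2"
  have M: "\<delta>\<^sup>2 \<le> M" "b \<le> M" "0 < M" using b \<delta> by (auto simp: M_def add_nonneg_pos)
  define \<tau> where "\<tau> = \<delta> / M"
  define r where "r = 1 - \<delta>\<^sup>2 / M"
  have \<tau>r: "0 < \<tau>" "0 \<le> r" "r < 1" using M \<delta> by (auto simp: \<tau>_def r_def)
  have "Nrm (cn (\<lambda>i. v i - of_real \<tau> * mat_app T v i)) \<le> ennreal r * Nrm (cn v)" if v: "Nrm (cn v) < top" for v
  proof -
    let ?z = "mat_app T v" and ?V = "infsum (sq v) UNIV"
    have z: "Nrm (cn ?z) < top" by (rule Nrm_mat_app_less_top[OF T v])
    have sv: "sq v summable_on UNIV" and sz: "sq ?z summable_on UNIV" using v z by (simp_all add: summable_sq)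
    have "Nrm (cn ?z) \<le> B * Nrm (cn v)"
      unfolding B_def by (rule order_trans[OF Nrm_mono Nrm_kop_le]) (rule mat_app_le_kop T)+
    then have zV: "infsum (sq ?z) UNIV \<le> M * ?V"
    proof -
      assume "Nrm (cn ?z) \<le> B * Nrm (cn v)"
      then have "infsum (sq ?z) UNIV \<le> b * ?V"
        unfolding Nrm_cn_eq_infsum[OF v] Nrm_cn_eq_infsum[OF z] b(1)
        using b(2) by (simp add: ennreal_mult[symmetric] infsum_nonneg)
      also have "\<dots> \<le> M * ?V" by (intro mult_right_mono M infsum_nonneg) simp
      finally show ?thesis .
    qed
    have expand: "sq (\<lambda>i. v i - of_real \<tau> * ?z i) i = sq v i + (- 2 * \<tau>) * Re (cnj (v i) * ?z i) + \<tau>\<^sup>2 * sq ?z i" for i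
      unfolding cmod_power2 by (simp add: power2_eq_square algebra_simps)
    have s2: "(\<lambda>i. (- 2 * \<tau>) * Re (cnj (v i) * ?z i)) summable_on UNIV" and s3: "(\<lambda>i. \<tau>\<^sup>2 * sq ?z i) summable_on UNIV"
      by (intro summable_on_cmult_right sz summable_Re_cross v z)+
    have summ: "(\<lambda>i. sq v i + (- 2 * \<tau>) * Re (cnj (v i) * ?z i) + \<tau>\<^sup>2 * sq ?z i) summable_on UNIV"
      by (intro summable_on_add sv s2 s3)
    have "infsum (sq (\<lambda>i. v i - of_real \<tau> * ?z i)) UNIV
        = ?V + (- 2 * \<tau>) * (\<Sum>\<^sub>\<infinity>i. Re (cnj (v i) * ?z i)) + \<tau>\<^sup>2 * infsum (sq ?z) UNIV"
      unfolding expand infsum_add[OF summable_on_add[OF sv s2] s3] infsum_add[OF sv s2]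
      by (simp only: infsum_cmult_right')
    also have "\<dots> \<le> ?V + (- 2 * \<tau>) * (\<delta> * ?V) + \<tau>\<^sup>2 * (M * ?V)"
      using coercive[OF v] zV \<tau>r(1) by (intro add_mono mult_left_mono mult_left_mono_neg) auto
    also have "\<dots> = r * ?V"
      using M by (simp add: \<tau>_def r_def power2_eq_square field_simps)
    finally have le: "infsum (sq (\<lambda>i. v i - of_real \<tau> * ?z i)) UNIV \<le> r * ?V" .
    have fin: "Nrm (cn (\<lambda>i. v i - of_real \<tau> * ?z i)) < top"
      unfolding summable_sq expand by (rule summ)
    show "Nrm (cn (\<lambda>i. v i - of_real \<tau> * ?z i)) \<le> ennreal r * Nrm (cn v)"
      unfolding Nrm_cn_eq_infsum[OF v] Nrm_cn_eq_infsum[OF fin]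
      using le \<tau>r(2) by (simp add: ennreal_mult'[symmetric] ennreal_leI)
  qed
  with \<tau>r show ?thesis by (intro that) auto
qed

text \<open>The solution is \<open>\<tau>\<close> times the Neumann series of
  \<open>I - \<tau> T\<close> applied to the unit vector at \<open>j\<close>. A uniform bound on its
  entries is recorded, as this is the condition in the pointwise bound.\<close>

lemma coercive_right_inverse:
  assumes T: "dominated t T" "pnorm CARD('d) t < top" and \<delta>: "0 < \<delta>"
    and coercive: "\<And>v. Nrm (cn v) < top \<Longrightarrow> \<delta> * infsum (sq v) UNIV \<le> (\<Sum>\<^sub>\<infinity>i. Re (cnj (v i) * mat_app T v i))"
  obtains g F where "F < top" "\<forall>i. cn g i \<le> F" "mat_app T g = (\<lambda>i. if i = j then 1 else 0)"
proof -
  obtain \<tau> r where \<tau>: "0 < \<tau>" and r: "0 \<le> r" "r < 1"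
    and contr: "\<forall>v. Nrm (cn v) < top \<longrightarrow> Nrm (cn (\<lambda>i. v i - of_real \<tau> * mat_app T v i)) \<le> ennreal r * Nrm (cn v)"
    by (rule coercive_contraction[OF T \<delta> coercive])
  define v where "v = rec_nat (\<lambda>i. if i = j then 1 else 0) (\<lambda>k u i. u i - of_real \<tau> * mat_app T u i)"
  have v0: "v 0 = (\<lambda>i. if i = j then 1 else 0)" and vS: "v (Suc k) = (\<lambda>i. v k i - of_real \<tau> * mat_app T (v k) i)" for k
    by (simp_all add: v_def)
  have Nv: "Nrm (cn (v k)) \<le> ennreal (r ^ k)" for k
  proof (induction k)
    case 0
    have "Nrm (cn (v 0)) = nsum (\<lambda>i. if i = j then 1 else 0)"
      unfolding Nrm_cn v0 by (intro nn_integral_cong) simp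
    then show ?case by (simp add: nsum_delta)
  next
    case (Suc k)
    have "Nrm (cn (v k)) < top" using Suc.IH by (rule le_less_trans) simp
    then have "Nrm (cn (v (Suc k))) \<le> ennreal r * Nrm (cn (v k))" unfolding vS using contr by blast
    also have "\<dots> \<le> ennreal r * ennreal (r ^ k)" by (intro mult_left_mono Suc.IH) simp
    finally show ?case using r by (simp add: ennreal_mult)
  qed
  \<comment> \<open>\<open>Nrm\<close> is the square of the norm, so the entries decay with the
    square root of \<open>r\<close>.\<close>
  define s where "s = r powr (1/2)"
  have s: "0 \<le> s" "s < 1"
    using r powr_less_mono2[of "1/2" r 1] by (auto simp: s_def)
  have sk: "(r ^ k) powr (1/2) = s ^ k" for k
    using r by (induction k) (auto simp: s_def powr_mult)
  have vk: "cn (v k) i \<le> ennreal (s ^ k)" for k i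
  proof -
    have "cn (v k) i \<le> epw (1/2) (Nrm (cn (v k)))" by (rule cn_bounded)
    also have "\<dots> \<le> epw (1/2) (ennreal (r ^ k))" by (intro epw_mono Nv) simp
    finally show ?thesis using r by (simp add: epw_ennreal sk)
  qed
  define U where "U = nsum (\<lambda>k. ennreal (s ^ k))"
  have U: "U < top"
    unfolding U_def nn_integral_count_space_nat less_top[symmetric]
    using s by (intro ennreal_suminf_neq_top summable_geometric) auto
  have absv: "nsum (\<lambda>k. ennreal (norm (v k i))) \<le> U" for i
    unfolding U_def by (intro nsum_mono vk)
  define g where "g i = of_real \<tau> * (\<Sum>\<^sub>\<infinity>k. v k i)" for i
  show ?thesis
  proof
    show "ennreal \<tau> * U < top" using U by (simp add: ennreal_mult_less_top)
    show "\<forall>i. cn g i \<le> ennreal \<tau> * U"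
    proof
      fix i
      have "cn g i = ennreal \<tau> * ennreal (norm (\<Sum>\<^sub>\<infinity>k. v k i))"
        using \<tau> by (simp add: g_def norm_mult ennreal_mult)
      also have "\<dots> \<le> ennreal \<tau> * U"
        by (intro mult_left_mono order_trans[OF norm_infsum_le_nsum absv]) simp
      finally show "cn g i \<le> ennreal \<tau> * U" .
    qed
    show "mat_app T g = (\<lambda>i. if i = j then 1 else 0)"
    proof
      fix i
      have "mat_app T g i = of_real \<tau> * (\<Sum>\<^sub>\<infinity>l. \<Sum>\<^sub>\<infinity>k. T i l * v k l)"
        unfolding g_def mat_app_cmult by (simp only: mat_app_def infsum_cmult_right')
      also have "(\<Sum>\<^sub>\<infinity>l. \<Sum>\<^sub>\<infinity>k. T i l * v k l) = (\<Sum>\<^sub>\<infinity>k. \<Sum>\<^sub>\<infinity>l. T i l * v k l)"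
      proof (rule infsum_swap_nsum)
        have "nsum (\<lambda>l. nsum (\<lambda>k. ennreal (norm (T i l * v k l)))) = nsum (\<lambda>l. ennreal (cmod (T i l)) * nsum (\<lambda>k. ennreal (norm (v k l))))"
          by (simp add: norm_mult ennreal_mult nsum_cmult)
        also have "\<dots> \<le> nsum (\<lambda>l. kern t (i - l) * U)"
          by (intro nsum_mono mult_mono dominatedD T absv) auto
        also have "\<dots> = pnorm CARD('d) t * U" by (simp only: kop_kern kop_const)
        also have "\<dots> < top" using T U by (simp add: ennreal_mult_less_top)
        finally show "nsum (\<lambda>l. nsum (\<lambda>k. ennreal (norm (T i l * v k l)))) < top" .
      qed
      also have "of_real \<tau> * (\<Sum>\<^sub>\<infinity>k. \<Sum>\<^sub>\<infinity>l. T i l * v k l) = (\<Sum>\<^sub>\<infinity>k. of_real \<tau> * mat_app T (v k) i)"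
        by (simp only: mat_app_def infsum_cmult_right')
      \<comment> \<open>\<open>\<tau>\<close> times the image of an iterate is the difference to the
        next one, so the series telescopes to the starting vector.\<close>
      also have "\<dots> = (\<Sum>\<^sub>\<infinity>k. v k i - v (Suc k) i)" by (simp add: vS)
      also have "\<dots> = v 0 i"
      proof -
        have "nsum (\<lambda>k. ennreal (norm (v k i - v (Suc k) i))) \<le> nsum (\<lambda>k. 2 * ennreal (s ^ k))"
        proof (rule nsum_mono)
          fix k
          have "norm (v k i - v (Suc k) i) \<le> s ^ k + s ^ Suc k"
            using vk[of k i] vk[of "Suc k" i] s by (intro order_trans[OF norm_triangle_ineq4] add_mono) auto
          also have "\<dots> \<le> 2 * s ^ k" using s by (simp add: mult_left_le_one_le)
          finally show "ennreal (norm (v k i - v (Suc k) i)) \<le> 2 * ennreal (s ^ k)"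
            using s by (simp add: ennreal_leI numeral_mult_ennreal)
        qed
        also have "\<dots> < top" using U by (simp add: nsum_cmult U_def ennreal_mult_less_top)
        finally have "(\<lambda>k. v k i - v (Suc k) i) summable_on UNIV"
          by (rule abs_summable_summable[OF abs_summable_if_nsum])
        then have "(\<lambda>k. v k i - v (Suc k) i) sums (\<Sum>\<^sub>\<infinity>k. v k i - v (Suc k) i)"
          by (intro has_sum_imp_sums has_sum_infsum)
        moreover have "(\<lambda>k. v k i) \<longlonglongrightarrow> 0"
        proof (rule Lim_null_comparison)
          show "\<forall>\<^sub>F k in sequentially. norm (v k i) \<le> s ^ k" using vk s by (intro always_eventually) auto
          show "(\<lambda>k. s ^ k) \<longlonglongrightarrow> 0" using s by (intro LIMSEQ_power_zero) auto
        qed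
        then have "(\<lambda>k. v k i - v (Suc k) i) sums (v 0 i - 0)" by (rule telescope_sums')
        ultimately show ?thesis using sums_unique2 by fastforce
      qed
      finally show "mat_app T g i = (if i = j then 1 else 0)" by (simp add: v0)
    qed
  qed
qed

text \<open>Inverse-closedness: column \<open>j\<close> of the inverse is bounded and
  \<open>T\<close> maps it to the unit vector at \<open>j\<close>, so the pointwise bound for
  \<open>T\<close> reads as domination by \<open>kern \<omega> (i - j)\<close>.\<close>

theorem coercive_dominated_inverse:
  assumes T: "dominated t T" "pnorm CARD('d) t < top" and \<delta>: "0 < \<delta>"
    and coercive: "\<And>v. Nrm (cn v) < top \<Longrightarrow> \<delta> * infsum (sq v) UNIV \<le> (\<Sum>\<^sub>\<infinity>i. Re (cnj (v i) * mat_app T v i))"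
  obtains G \<omega> where "pnorm CARD('d) \<omega> < top" "dominated \<omega> G"
    "\<forall>j. mat_app T (\<lambda>l. G l j) = (\<lambda>i. if i = j then 1 else 0)"
proof -
  have stable: "Nrm (cn c) \<le> ennreal (1 / \<delta>\<^sup>2) * Nrm (cn (mat_app T c))" if "finite {i. c i \<noteq> 0}" for c
  proof (rule coercive_lower_bound[OF T \<delta> coercive])
    have "Nrm (cn c) = Nrm (\<lambda>i. if i \<in> {i. c i \<noteq> 0} then cn c i else 0)"
      by (intro arg_cong[where f=Nrm] ext) simp
    also have "\<dots> < top"
      unfolding Nrm_restrict[OF that] using that by (simp add: w_eq_1 epw_2_ennreal less_top[symmetric])
    finally show "Nrm (cn c) < top" .
  qed
  obtain \<omega> where \<omega>: "pnorm CARD('d) \<omega> < top"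
    "\<forall>c F. F < top \<and> (\<forall>i. cn c i \<le> F) \<longrightarrow> (\<forall>i. cn c i \<le> kop \<omega> (cn (mat_app T c)) i)"
    by (rule pointwise_bound_if_stable[OF T ennreal_less_top stable])
  have "\<exists>g. (\<exists>F<top. \<forall>i. cn g i \<le> F) \<and> mat_app T g = (\<lambda>i. if i = j then 1 else 0)" for j
  proof -
    obtain g F where "F < top" "\<forall>i. cn g i \<le> F" "mat_app T g = (\<lambda>i. if i = j then 1 else 0)"
      by (rule coercive_right_inverse[OF T \<delta> coercive])
    then show ?thesis by blast
  qed
  then obtain g where g: "\<And>j. \<exists>F<top. \<forall>i. cn (g j) i \<le> F" "\<And>j. mat_app T (g j) = (\<lambda>i. if i = j then 1 else 0)"
    by metis
  show ?thesis
  proof (rule that[of \<omega> "\<lambda>l j. g j l"])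
    show "dominated \<omega> (\<lambda>l j. g j l)"
      unfolding dominated_def
    proof (intro allI)
      fix i j
      obtain F where "F < top" "\<forall>i. cn (g j) i \<le> F" using g(1) by blast
      then have "cn (g j) i \<le> kop \<omega> (cn (mat_app T (g j))) i" using \<omega>(2) by blast
      also have "\<dots> = kop \<omega> (\<lambda>l. if l = j then 1 else 0) i"
        unfolding g(2) by (rule arg_cong[where f="\<lambda>f. kop \<omega> f i"]) auto
      finally show "ennreal (cmod (g j i)) \<le> kern \<omega> (i - j)" by (simp add: kop_delta)
    qed
  qed (use \<omega>(1) g(2) in auto)
qed

text \<open>Moves \<open>adj A\<close> to the other side of the inner product. The double sum is
  swapped by Fubini, with absolute convergence from the boundedness of \<open>kop a\<close> on
  l^2.\<close>

lemma adj_form: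
  assumes A: "dominated a A" "pnorm CARD('d) a < top" and v: "Nrm (cn v) < top"
  shows "(\<Sum>\<^sub>\<infinity>i. Re (cnj (v i) * mat_app (mat_mul (adj A) A) v i)) = infsum (sq (mat_app A v)) UNIV"
proof -
  let ?y = "mat_app A v" and ?T = "mat_mul (adj A) A"
  have y: "Nrm (cn ?y) < top" by (rule Nrm_mat_app_less_top[OF A v])
  have kk: "Nrm (kop a (kop a (cn v))) < top" by (intro Nrm_kop_less_top A v)
  have Tv: "mat_app ?T v i = mat_app (adj A) ?y i" for i
    by (rule mat_app_mat_app[OF dominated_adj[OF A(1)] A(1), symmetric]) (rule Nrm_less_topD[OF kk])
  have z: "Nrm (cn (mat_app (adj A) ?y)) < top" by (rule Nrm_mat_app_less_top[OF dominated_adj[OF A(1)] A(2) y])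
  have "(\<Sum>\<^sub>\<infinity>i. cnj (v i) * mat_app (adj A) ?y i) = (\<Sum>\<^sub>\<infinity>i. \<Sum>\<^sub>\<infinity>l. cnj (v i) * (adj A i l * ?y l))"
    unfolding mat_app_def[of "adj A"] by (simp only: infsum_cmult_right')
  also have "\<dots> = (\<Sum>\<^sub>\<infinity>l. \<Sum>\<^sub>\<infinity>i. cnj (v i) * (adj A i l * ?y l))"
  proof (rule infsum_swap_nsum)
    have "nsum (\<lambda>i. nsum (\<lambda>l. ennreal (norm (cnj (v i) * (adj A i l * ?y l)))))
        = nsum (\<lambda>i. cn v i * nsum (\<lambda>l. ennreal (norm (adj A i l * ?y l))))"
      by (simp add: norm_mult[of "cnj _"] ennreal_mult nsum_cmult)
    also have "\<dots> \<le> nsum (\<lambda>i. epw 2 (cn v i) + epw 2 (kop a (cn ?y) i))"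
      by (intro nsum_mono order_trans[OF mult_left_mono[OF row_sum_le_kop] ennreal_mult_le_sum_epw_2] dominated_adj A) simp
    also have "\<dots> = Nrm (cn v) + Nrm (kop a (cn ?y))" by (simp add: nsum_add Nrm_eq)
    also have "\<dots> < top" using v Nrm_kop_less_top[OF A(2) y] by simp
    finally show "nsum (\<lambda>i. nsum (\<lambda>l. ennreal (norm (cnj (v i) * (adj A i l * ?y l))))) < top" .
  qed
  also have "\<dots> = (\<Sum>\<^sub>\<infinity>l. cnj (?y l) * ?y l)"
  proof (rule infsum_cong)
    fix l
    have "(\<Sum>\<^sub>\<infinity>i. cnj (v i) * (adj A i l * ?y l)) = (\<Sum>\<^sub>\<infinity>i. cnj (A l i * v i) * ?y l)"
      by (simp add: adj_def ac_simps)
    also have "\<dots> = cnj (?y l) * ?y l"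
      unfolding mat_app_def by (simp only: infsum_cmult_left' infsum_cnj)
    finally show "(\<Sum>\<^sub>\<infinity>i. cnj (v i) * (adj A i l * ?y l)) = cnj (?y l) * ?y l" .
  qed
  finally have "(\<Sum>\<^sub>\<infinity>i. Re (cnj (v i) * mat_app (adj A) ?y i)) = (\<Sum>\<^sub>\<infinity>l. Re (cnj (?y l) * ?y l))"
    by (simp only: infsum_Re[OF abs_summable_summable[OF summable_cross]] v z y)
  also have "\<dots> = infsum (sq ?y) UNIV"
    by (intro infsum_cong) (subst cmod_power2, simp add: power2_eq_square)
  finally show ?thesis by (simp only: Tv)
qed

text \<open>Taking l^2 norms in the pointwise bound makes \<open>mat_mul (adj A) A\<close> coercive,
  which yields a dominated right inverse. The matrix is Hermitian, so the adjoint of a right inverse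
  is a left inverse.\<close>

theorem dominated_left_inverse:
  fixes A :: "'d inf_matrix"
  assumes A: "dominated a A" "pnorm CARD('d) a < top" and \<omega>: "pnorm CARD('d) \<omega> < top"
    and bound: "\<forall>c F. F < top \<and> (\<forall>i. cn c i \<le> F) \<longrightarrow> (\<forall>i. cn c i \<le> kop \<omega> (cn (mat_app A c)) i)"
  obtains G g where "pnorm CARD('d) g < top" "dominated g G"
    "mat_mul G (mat_mul (adj A) A) = (\<lambda>i j. if i = j then 1 else 0)"
proof -
  let ?T = "mat_mul (adj A) A" and ?t = "pconv CARD('d) a a"
  have T: "dominated ?t ?T" by (rule dominated_mat_mul[OF dominated_adj[OF A(1)] A(1)])
  have t: "pnorm CARD('d) ?t < top"
    by (rule le_less_trans[OF pnorm_pconv_le]) (use A in \<open>simp add: ennreal_mult_less_top power_less_top_ennreal\<close>)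
  define B where "B = avg_const CARD('d) 2 C0 * epw 2 (pnorm CARD('d) \<omega>)"
  have "B < top" using \<omega> avg_const_fin by (simp add: B_def ennreal_mult_less_top epw_less_top)
  then obtain b where b: "B = ennreal b" "0 \<le> b" by (cases B) auto
  \<comment> \<open>\<open>b + 1\<close> instead of \<open>b\<close> keeps the coercivity constant
    positive if \<open>b = 0\<close>.\<close>
  have coercive: "1 / (b + 1) * infsum (sq v) UNIV \<le> (\<Sum>\<^sub>\<infinity>i. Re (cnj (v i) * mat_app ?T v i))" if v: "Nrm (cn v) < top" for v
  proof -
    have y: "Nrm (cn (mat_app A v)) < top" by (rule Nrm_mat_app_less_top[OF A v])
    have "epw (1/2) (Nrm (cn v)) < top \<and> (\<forall>i. cn v i \<le> epw (1/2) (Nrm (cn v)))"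
      using cn_bounded epw_less_top[OF v] by simp
    then have "\<forall>i. cn v i \<le> kop \<omega> (cn (mat_app A v)) i" using bound by blast
    then have "Nrm (cn v) \<le> Nrm (kop \<omega> (cn (mat_app A v)))" by (intro Nrm_mono) simp
    also have "\<dots> \<le> B * Nrm (cn (mat_app A v))" unfolding B_def by (rule Nrm_kop_le[OF \<omega>])
    finally have "infsum (sq v) UNIV \<le> b * infsum (sq (mat_app A v)) UNIV"
      unfolding Nrm_cn_eq_infsum[OF v] Nrm_cn_eq_infsum[OF y] b(1)
      using b(2) by (simp add: ennreal_mult[symmetric] infsum_nonneg)
    also have "\<dots> \<le> (b + 1) * infsum (sq (mat_app A v)) UNIV"
      by (intro mult_right_mono infsum_nonneg) auto
    finally show ?thesis
      unfolding adj_form[OF A v] using b(2) by (simp add: field_simps)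
  qed
  have "0 < 1 / (b + 1)" using b(2) by simp
  then obtain G g where G: "pnorm CARD('d) g < top" "dominated g G"
    "\<forall>j. mat_app ?T (\<lambda>l. G l j) = (\<lambda>i. if i = j then 1 else 0)"
    by (rule coercive_dominated_inverse[OF T t _ coercive])
  have herm: "cnj (?T l j) = ?T j l" for l j
    unfolding mat_mul_def mat_app_def infsum_cnj[symmetric] by (simp add: adj_def mult.commute)
  show ?thesis
  proof (rule that[of g "adj G"])
    show "mat_mul (adj G) ?T = (\<lambda>i j. if i = j then 1 else 0)"
    proof (intro ext)
      fix i j
      have "mat_mul (adj G) ?T i j = (\<Sum>\<^sub>\<infinity>l. cnj (G l i) * ?T l j)"
        by (simp add: mat_mul_def[of "adj G"] mat_app_def adj_def[of G])
      also have "\<dots> = (\<Sum>\<^sub>\<infinity>l. cnj (?T j l * G l i))"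
        by (intro infsum_cong) (simp add: herm[symmetric, of _ j] mult.commute)
      also have "\<dots> = cnj (mat_app ?T (\<lambda>l. G l i) j)" by (simp only: infsum_cnj mat_app_def)
      finally show "mat_mul (adj G) ?T i j = (if i = j then 1 else 0)" by (simp add: G(3))
    qed
  qed (use G dominated_adj in auto)
qed

end

section \<open>Back to the weighted space: the two directions of the equivalence\<close>

lemma mat_app_id: "mat_app (\<lambda>i j. if i = j then 1 else 0) c = c"
proof
  fix i
  have "mat_app (\<lambda>i j. if i = j then 1 else 0) c i = infsum (\<lambda>j. c j) {i}"
    unfolding mat_app_def by (rule infsum_cong_neutral) auto
  then show "mat_app (\<lambda>i j. if i = j then 1 else 0) c i = c i" by simp
qed

theorem corollary1p3:
  fixes q :: real and w :: "int ^ 'd::finite \<Rightarrow> real" and A :: "'d inf_matrix"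
  assumes "1 \<le> q"
    and "discrete_A_weight q w"
    and "A \<in> B_class"
  shows "lq_stable q w A \<longleftrightarrow> has_left_inverse q w A"
proof -
  have q0: "0 < q" and w0: "0 < w i" for i using assms by (auto simp: discrete_A_weight_def)
  obtain C0 where "aq_weight q (\<lambda>i. ennreal (w i)) C0"
    using aq_weight_if_discrete_A_weight[OF assms(1,2)] .
  then interpret aq_weight q "\<lambda>i. ennreal (w i)" C0 .
  have "(1 :: real) \<le> 2" by simp
  then obtain C2 where "aq_weight 2 (\<lambda>i :: int ^ 'd. ennreal 1) C2"
    by (rule aq_weight_if_discrete_A_weight[OF _ discrete_A_weight_1])
  then interpret L2: l2_weight "\<lambda>i :: int ^ 'd. ennreal 1" C2
    by (simp add: l2_weight_def l2_weight_axioms_def)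
  obtain a where a: "pnorm CARD('d) a < top" "dominated a A" using B_class_dominated[OF assms(3)] .
  have Nrm_cn: "Nrm (cn c) = nsum (\<lambda>i. ennreal (cmod (c i) powr q * w i))" for c
    unfolding Nrm_def by (intro nn_integral_cong) (simp add: epw_ennreal ennreal_mult w0 less_imp_le mult.commute)
  have lq_iff: "c \<in> lq q w \<longleftrightarrow> Nrm (cn c) < top" for c
    unfolding Nrm_cn lq_def mem_Collect_eq using w0 by (intro summable_on_iff_nsum) (simp add: less_imp_le)
  have Nrm_eq: "Nrm (cn c) = ennreal (lq_norm q w c powr q)" if "c \<in> lq q w" for c
  proof -
    have "Nrm (cn c) = ennreal (\<Sum>\<^sub>\<infinity>i. cmod (c i) powr q * w i)"
      unfolding Nrm_cn using that w0 by (intro nsum_eq_infsum) (auto simp: lq_def less_imp_le)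
    moreover have "0 \<le> (\<Sum>\<^sub>\<infinity>i. cmod (c i) powr q * w i)"
      using w0 by (intro infsum_nonneg) (simp add: less_imp_le)
    ultimately show ?thesis using q0 by (simp add: lq_norm_def powr_powr)
  qed
  have nonneg: "0 \<le> lq_norm q w c" for c by (simp add: lq_norm_def)
  \<comment> \<open>\<open>Nrm\<close> is the q-th power of the norm, so a constant \<open>K\<close>
    turns into \<open>K powr q\<close>.\<close>
  have norm_le: "lq_norm q w c \<le> K * lq_norm q w d \<longleftrightarrow> Nrm (cn c) \<le> ennreal (K powr q) * Nrm (cn d)"
    if "c \<in> lq q w" "d \<in> lq q w" "0 \<le> K" for c d K
  proof -
    have n: "0 \<le> lq_norm q w c" "0 \<le> K * lq_norm q w d" using nonneg that(3) by simp_all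
    have "Nrm (cn c) \<le> ennreal (K powr q) * Nrm (cn d) \<longleftrightarrow> lq_norm q w c powr q \<le> (K * lq_norm q w d) powr q"
      using that nonneg by (simp add: Nrm_eq ennreal_mult[symmetric] powr_mult)
    also have "\<dots> \<longleftrightarrow> lq_norm q w c \<le> K * lq_norm q w d"
      using powr_mono2[OF _ n(1), of q "K * lq_norm q w d"] powr_less_mono2[OF q0 n(2), of "lq_norm q w c"] q0
      by (meson less_imp_le not_le)
    finally show ?thesis by simp
  qed
  have op: "\<exists>K>0. \<forall>c\<in>lq q w. mat_app B c \<in> lq q w \<and> lq_norm q w (mat_app B c) \<le> K * lq_norm q w c"
    if b: "pnorm CARD('d) b < top" "dominated b B" for b B
  proof -
    let ?K = "avg_const CARD('d) q C0 * epw q (pnorm CARD('d) b)"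
    have "?K < top" using b avg_const_fin by (simp add: ennreal_mult_less_top epw_less_top)
    then obtain k where k: "?K = ennreal k" "0 \<le> k" by (cases ?K) auto
    define K where "K = (k + 1) powr (1 / q)"
    have K: "0 < K" "K powr q = k + 1" using k q0 by (auto simp: K_def powr_powr)
    have N: "Nrm (cn (mat_app B c)) \<le> ?K * Nrm (cn c)" for c
      by (rule order_trans[OF Nrm_mono Nrm_kop_le]) (rule mat_app_le_kop b)+
    have N': "?K * Nrm (cn c) \<le> ennreal (K powr q) * Nrm (cn c)" for c
      unfolding k K by (intro mult_right_mono ennreal_leI) auto
    have mem: "mat_app B c \<in> lq q w" if "c \<in> lq q w" for c
    proof -
      have "?K * Nrm (cn c) < top" using that unfolding lq_iff k by (simp add: ennreal_mult_less_top)
      with N[of c] show ?thesis unfolding lq_iff by (rule le_less_trans)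
    qed
    have "lq_norm q w (mat_app B c) \<le> K * lq_norm q w c" if "c \<in> lq q w" for c
      using norm_le[OF mem[OF that] that] K(1) order_trans[OF N[of c] N'[of c]] by simp
    then show ?thesis using K(1) mem by blast
  qed
  show ?thesis
  proof
    assume "has_left_inverse q w A"
    then obtain B where "bounded_op q w B" and inv: "\<forall>c\<in>lq q w. mat_app A c \<in> lq q w \<and> B (mat_app A c) = c"
      unfolding has_left_inverse_def by blast
    then obtain K where B: "\<forall>c\<in>lq q w. lq_norm q w (B c) \<le> K * lq_norm q w c"
      unfolding bounded_op_def by blast
    obtain K' where K': "0 < K'"
      "\<forall>c\<in>lq q w. mat_app A c \<in> lq q w \<and> lq_norm q w (mat_app A c) \<le> K' * lq_norm q w c"
      using op[OF a] by blast
    \<comment> \<open>The bound \<open>K\<close> of the left inverse carries no sign; the maximum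
      with \<open>K' > 0\<close> is a positive constant.\<close>
    define C where "C = max K K'"
    have C: "0 < C" "K \<le> C" "K' \<le> C" using K' by (auto simp: C_def)
    show "lq_stable q w A"
      unfolding lq_stable_def
    proof (intro exI[of _ C] conjI ballI)
      fix c assume c: "c \<in> lq q w"
      show "mat_app A c \<in> lq q w" using inv c by simp
      have "lq_norm q w c \<le> K * lq_norm q w (mat_app A c)"
        using B[rule_format, of "mat_app A c"] inv[rule_format, OF c] by simp
      also have "\<dots> \<le> C * lq_norm q w (mat_app A c)" by (intro mult_right_mono C nonneg)
      finally show "inverse C * lq_norm q w c \<le> lq_norm q w (mat_app A c)"
        using C by (simp add: field_simps)
      have "lq_norm q w (mat_app A c) \<le> K' * lq_norm q w c" using K'(2) c by blast
      also have "\<dots> \<le> C * lq_norm q w c" by (intro mult_right_mono C nonneg)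
      finally show "lq_norm q w (mat_app A c) \<le> C * lq_norm q w c" .
    qed (rule C)
  next
    assume "lq_stable q w A"
    then obtain C where C: "0 < C" and st: "\<forall>c\<in>lq q w. mat_app A c \<in> lq q w \<and>
        inverse C * lq_norm q w c \<le> lq_norm q w (mat_app A c)"
      unfolding lq_stable_def by blast
    have stable: "Nrm (cn c) \<le> ennreal (C powr q) * Nrm (cn (mat_app A c))" if "finite {i. c i \<noteq> 0}" for c
    proof -
      have "Nrm (cn c) = Nrm (\<lambda>i. if i \<in> {i. c i \<noteq> 0} then cn c i else 0)"
        by (intro arg_cong[where f=Nrm] ext) simp
      also have "\<dots> < top"
        unfolding Nrm_restrict[OF that] using that
        by (auto simp: less_top[symmetric] epw_ennreal ennreal_mult_eq_top_iff)
      finally have c: "c \<in> lq q w" by (simp add: lq_iff)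
      then have "lq_norm q w c \<le> C * lq_norm q w (mat_app A c)"
        using st[rule_format, OF c] C by (simp add: field_simps)
      then show ?thesis using norm_le[of c "mat_app A c" C] c st[rule_format, OF c] C by simp
    qed
    obtain \<omega> where \<omega>: "pnorm CARD('d) \<omega> < top"
      "\<forall>c F. F < top \<and> (\<forall>i. cn c i \<le> F) \<longrightarrow> (\<forall>i. cn c i \<le> kop \<omega> (cn (mat_app A c)) i)"
      by (rule pointwise_bound_if_stable[OF a(2,1) ennreal_less_top stable])
    \<comment> \<open>The bound obtained from weighted stability contains no weight, so it can be
      used in the l^2 instance.\<close>
    obtain G g where G: "pnorm CARD('d) g < top" "dominated g G"
      "mat_mul G (mat_mul (adj A) A) = (\<lambda>i j. if i = j then 1 else 0)"
      by (rule L2.dominated_left_inverse[OF a(2,1) \<omega>])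
    let ?S = "adj A" and ?T = "mat_mul (adj A) A" and ?t = "pconv CARD('d) a a"
    have S: "dominated a ?S" by (rule dominated_adj[OF a(2)])
    have T: "dominated ?t ?T" by (intro dominated_mat_mul S a)
    have t: "pnorm CARD('d) ?t < top"
      by (rule le_less_trans[OF pnorm_pconv_le]) (use a in \<open>simp add: ennreal_mult_less_top power_less_top_ennreal\<close>)
    \<comment> \<open>The absolute convergence that additivity and associativity require on
      \<open>lq q w\<close>.\<close>
    have kfin: "kop b (cn c) i < top" if "pnorm CARD('d) b < top" "c \<in> lq q w" for b c i
      using that by (intro Nrm_less_topD[OF Nrm_kop_less_top]) (auto simp: lq_iff)
    have kkfin: "kop b (kop b' (cn c)) i < top"
      if "pnorm CARD('d) b < top" "pnorm CARD('d) b' < top" "c \<in> lq q w" for b b' c i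
      using that by (intro Nrm_less_topD[OF Nrm_kop_less_top] Nrm_kop_less_top) (auto simp: lq_iff)
    \<comment> \<open>The usual left inverse \<open>(A^* A)^-1 A^*\<close>, composed of dominated
      matrices and hence bounded on \<open>lq q w\<close>.\<close>
    define B where "B c = mat_app G (mat_app ?S c)" for c
    have left: "B (mat_app A c) = c" if c: "c \<in> lq q w" for c
    proof -
      have "mat_app ?S (mat_app A c) = mat_app ?T c"
        by (intro ext mat_app_mat_app[OF S a(2)] kkfin a c)
      then have "B (mat_app A c) = mat_app (mat_mul G ?T) c"
        unfolding B_def by (intro ext) (simp add: mat_app_mat_app[OF G(2) T kkfin[OF G(1) t c]])
      then show ?thesis by (simp only: G(3) mat_app_id)
    qed
    obtain K1 where K1: "0 < K1" "\<forall>c\<in>lq q w. mat_app ?S c \<in> lq q w \<and> lq_norm q w (mat_app ?S c) \<le> K1 * lq_norm q w c"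
      using op[OF a(1) S] by blast
    obtain K2 where K2: "0 < K2" "\<forall>c\<in>lq q w. mat_app G c \<in> lq q w \<and> lq_norm q w (mat_app G c) \<le> K2 * lq_norm q w c"
      using op[OF G(1,2)] by blast
    have "bounded_op q w B"
      unfolding bounded_op_def
    proof (intro conjI ballI allI exI[of _ "K2 * K1"])
      fix c assume c: "c \<in> lq q w"
      have Sc: "mat_app ?S c \<in> lq q w" using K1(2)[rule_format, OF c] by simp
      show "B c \<in> lq q w" unfolding B_def using K2(2)[rule_format, OF Sc] by simp
      have "lq_norm q w (B c) \<le> K2 * lq_norm q w (mat_app ?S c)" unfolding B_def using K2(2)[rule_format, OF Sc] by simp
      also have "\<dots> \<le> K2 * (K1 * lq_norm q w c)" using K1(2)[rule_format, OF c] K2(1) by (intro mult_left_mono) auto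
      finally show "lq_norm q w (B c) \<le> K2 * K1 * lq_norm q w c" by (simp add: mult.assoc)
      show "B (\<lambda>i. z * c i) = (\<lambda>i. z * B c i)" for z
      proof -
        have "mat_app ?S (\<lambda>i. z * c i) = (\<lambda>i. z * mat_app ?S c i)" by (intro ext mat_app_cmult)
        then show ?thesis unfolding B_def by (intro ext) (simp only: mat_app_cmult)
      qed
      fix c' assume c': "c' \<in> lq q w"
      have Sc': "mat_app ?S c' \<in> lq q w" using K1(2)[rule_format, OF c'] by simp
      have "mat_app ?S (\<lambda>i. c i + c' i) = (\<lambda>i. mat_app ?S c i + mat_app ?S c' i)"
        by (intro ext mat_app_add[OF S] kfin a c c')
      then show "B (\<lambda>i. c i + c' i) = (\<lambda>i. B c i + B c' i)"
        unfolding B_def by (intro ext) (simp only: mat_app_add[OF G(2) kfin[OF G(1) Sc] kfin[OF G(1) Sc']])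
    qed
    then show "has_left_inverse q w A"
      unfolding has_left_inverse_def using st left by blast
  qed
qed

end
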